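(* One has $$H^*(C_6,E_*/2)=\mathbb{F}_4[[u_1^3]]\big[\,[u_1u^{-1}],\,[u^{-3}]^{\pm1},\,w\,\big],\qquad w=\alpha u^{-2},$$ that is, under the identification $H^*(C_6,E_*/2)\cong H^*(C_2,E_*/2)^{C_3}$, the ring $H^*(C_6,E_*/2)$ is the subring of $H^*(C_2,E_*/2)=\mathbb{F}_4[[u_1]][u^{\pm1}][\alpha]$ generated over $\mathbb{F}_4[[u_1^3]]$ by the elements $u_1u^{-1}$, $u^{-3}$, $(u^{-3})^{-1}=u^3$ and $w=\alpha u^{-2}$.
   Context: $E=E_2$ is the Morava $E$-theory spectrum of height $2$ at the prime $2$, with $E_*=\mathbb{W}[[u_1]][u^{\pm1}]$, $\mathbb{W}=W(\mathbb{F}_4)$, $|u_1|=0$, $|u|=-2$. The group $C_6=C_2\times C_3$ is the subgroup of the Morava stabilizer group $\mathbb{G}_2\cong(W(\mathbb{F}_4)\langle S\rangle/(Sa^\sigma=aS,\,S^2=2))^\times$ (with $\sigma$ the lift of Frobenius) with $C_2=\{\pm1\}$ and $C_3=\mathbb{F}_4^\times=\langle\zeta\rangle$. The subgroup $C_2$ acts trivially on $E_0$ and by $-1$ on $u$. One has $H^*(C_2,E_*/2)=\mathbb{F}_4[[u_1]][u^{\pm1}][\alpha]$, where $\alpha$ (cohomological degree $1$, internal degree $2$) is the reduction of the image in $H^1(C_2,E_2)$ of the generator of $H^1(C_2,\mathbb{Z}[\mathrm{sgn}])$ under the map sending the generator of the sign representation to $u^{-1}$. The residual action of $C_3$ is by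 ($\mathbb{F}_4$-linear, continuous) ring automorphisms determined by $\zeta\cdot u_1=\omega u_1$, $\zeta\cdot u=\omega u$, $\zeta\cdot\alpha=\omega^2\alpha$, where $\omega$ is a primitive third root of unity. *)

theory Defs
  imports
    "HOL-Library.Cardinality"
    "HOL-Library.Poly_Mapping"
    "HOL-Computational_Algebra.Formal_Power_Series"
    "HOL-Algebra.Generated_Rings"
    "HOL-Algebra.Algebraic_Closure_Type"
begin

section \<open>The cohomology ring of a group acting on a commutative ring\<close>

text \<open>
  A group \<open>G\<close> acts on a commutative ring via \<open>\<rho>\<close>. We use homogeneous cochains and put
  all cohomological degrees together in a single ring: an \<open>n\<close>-cochain is a function on lists
  \<open>[g\<^sub>0, \<dots>, g\<^sub>n]\<close> of length \<open>n + 1\<close> over \<open>G\<close>, and a function on lists that vanishes on the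
  empty list, on lists that leave \<open>G\<close> and on all sufficiently long lists is an element
  of the direct sum of the cochain groups over all \<open>n\<close>.
\<close>

definition cochains ::
    "('g, 'b) monoid_scheme \<Rightarrow> ('g \<Rightarrow> 'm \<Rightarrow> 'm) \<Rightarrow> ('g list \<Rightarrow> 'm::comm_ring_1) set" where
  "cochains G \<rho> = {f.
     (\<forall>xs. f xs \<noteq> 0 \<longrightarrow> xs \<noteq> [] \<and> set xs \<subseteq> carrier G) \<and>
     (\<exists>N. \<forall>xs. length xs > N \<longrightarrow> f xs = 0) \<and>
     (\<forall>g\<in>carrier G. \<forall>xs\<in>lists (carrier G). f (map (\<lambda>x. g \<otimes>\<^bsub>G\<^esub> x) xs) = \<rho> g (f xs))}"

text \<open>
  The differential \<open>(df)(g\<^sub>0, \<dots>, g\<^sub>n) = (\<Sum>i\<le>n. (-1)\<^sup>i f(\<dots>, g\<^sub>i omitted, \<dots>))\<close>; it vanishes on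
  lists of length 1 because cochains vanish on the empty list.
\<close>

definition coboundary :: "('g, 'b) monoid_scheme \<Rightarrow> ('g list \<Rightarrow> 'm) \<Rightarrow> ('g list \<Rightarrow> 'm::comm_ring_1)" where
  "coboundary G f xs =
     (if set xs \<subseteq> carrier G
      then \<Sum>i<length xs. (-1) ^ i * f (take i xs @ drop (Suc i) xs) else 0)"

text \<open>
  The cup product \<open>(f \<union> h)(g\<^sub>0, \<dots>, g\<^sub>n) = f(g\<^sub>0, \<dots>, g\<^sub>p) * h(g\<^sub>p, \<dots>, g\<^sub>n)\<close>, summed over all \<open>p\<close>
  since \<open>f\<close> and \<open>h\<close> need not be concentrated in one degree.
\<close>

definition cup :: "('g list \<Rightarrow> 'm) \<Rightarrow> ('g list \<Rightarrow> 'm) \<Rightarrow> ('g list \<Rightarrow> 'm::comm_ring_1)" where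
  "cup f h xs = (\<Sum>p<length xs. f (take (Suc p) xs) * h (drop p xs))"

definition const_cochain :: "('g, 'b) monoid_scheme \<Rightarrow> 'm \<Rightarrow> ('g list \<Rightarrow> 'm::comm_ring_1)" where
  "const_cochain G a xs = (if length xs = 1 \<and> set xs \<subseteq> carrier G then a else 0)"

definition cocycle_ring ::
    "('g, 'b) monoid_scheme \<Rightarrow> ('g \<Rightarrow> 'm \<Rightarrow> 'm) \<Rightarrow> ('g list \<Rightarrow> 'm::comm_ring_1) ring" where
  "cocycle_ring G \<rho> =
     \<lparr>carrier = {f \<in> cochains G \<rho>. coboundary G f = (\<lambda>_. 0)},
      monoid.mult = cup, one = const_cochain G 1,
      zero = (\<lambda>_. 0), add = (\<lambda>f h xs. f xs + h xs)\<rparr>"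

definition cohomology_ring ::
    "('g, 'b) monoid_scheme \<Rightarrow> ('g \<Rightarrow> 'm \<Rightarrow> 'm) \<Rightarrow> ('g list \<Rightarrow> 'm::comm_ring_1) set ring" where
  "cohomology_ring G \<rho> = cocycle_ring G \<rho> Quot (coboundary G ` cochains G \<rho>)"

definition cohomology_class ::
    "('g, 'b) monoid_scheme \<Rightarrow> ('g \<Rightarrow> 'm \<Rightarrow> 'm) \<Rightarrow> ('g list \<Rightarrow> 'm::comm_ring_1)
       \<Rightarrow> ('g list \<Rightarrow> 'm) set" where
  "cohomology_class G \<rho> f = (coboundary G ` cochains G \<rho>) +>\<^bsub>cocycle_ring G \<rho>\<^esub> f"

text \<open>Restriction from \<open>G\<close> to a subgroup with underlying set \<open>H\<close>.\<close>

definition restriction ::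
    "('g, 'b) monoid_scheme \<Rightarrow> ('g \<Rightarrow> 'm \<Rightarrow> 'm) \<Rightarrow> 'g set
       \<Rightarrow> ('g list \<Rightarrow> 'm::comm_ring_1) set \<Rightarrow> ('g list \<Rightarrow> 'm) set" where
  "restriction G \<rho> H Y =
     (\<Union>f\<in>Y. cohomology_class (G\<lparr>carrier := H\<rparr>) \<rho> (\<lambda>xs. if set xs \<subseteq> H then f xs else 0))"

text \<open>
  The action of \<open>g \<in> G\<close> on the cohomology of a normal subgroup \<open>H\<close>, given on cochains by
  \<open>(g f)(h\<^sub>0, \<dots>, h\<^sub>n) = g (f (g\<inverse> h\<^sub>0 g, \<dots>, g\<inverse> h\<^sub>n g))\<close>.
\<close>

definition residual_action ::
    "('g, 'b) monoid_scheme \<Rightarrow> ('g \<Rightarrow> 'm \<Rightarrow> 'm) \<Rightarrow> 'g set \<Rightarrow> 'g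
       \<Rightarrow> ('g list \<Rightarrow> 'm::comm_ring_1) set \<Rightarrow> ('g list \<Rightarrow> 'm) set" where
  "residual_action G \<rho> H g Y =
     (\<Union>f\<in>Y. cohomology_class (G\<lparr>carrier := H\<rparr>) \<rho>
        (\<lambda>xs. if set xs \<subseteq> H
              then \<rho> g (f (map (\<lambda>x. inv\<^bsub>G\<^esub> g \<otimes>\<^bsub>G\<^esub> x \<otimes>\<^bsub>G\<^esub> g) xs)) else 0))"

definition residual_invariants ::
    "('g, 'b) monoid_scheme \<Rightarrow> ('g \<Rightarrow> 'm \<Rightarrow> 'm) \<Rightarrow> 'g set \<Rightarrow> 'g set
       \<Rightarrow> ('g list \<Rightarrow> 'm::comm_ring_1) set set" where
  "residual_invariants G \<rho> H K =
     {Y \<in> carrier (cohomology_ring (G\<lparr>carrier := H\<rparr>) \<rho>). \<forall>g\<in>K. residual_action G \<rho> H g Y = Y}"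


section \<open>The coefficient ring and the group action\<close>

text \<open>
  \<open>E\<^sub>*/2 = \<bbbF>\<^sub>4[[u\<^sub>1]][u\<^sup>\<plusminus>\<^sup>1]\<close> as Laurent polynomials (finitely supported functions on the integers)
  over formal power series; the type \<open>'f\<close> stands for a field with four elements.
\<close>

type_synonym 'f E2 = "int \<Rightarrow>\<^sub>0 'f fps"

definition ser :: "'f::field fps \<Rightarrow> 'f E2" where
  "ser c = Poly_Mapping.single 0 c"

definition u1 :: "'f::field E2" where
  "u1 = ser fps_X"

definition u_pow :: "int \<Rightarrow> 'f::field E2" where
  "u_pow k = Poly_Mapping.single k 1"

text \<open>The \<open>'f\<close>-linear continuous ring endomorphism with \<open>u\<^sub>1 \<mapsto> a u\<^sub>1\<close> and \<open>u \<mapsto> b u\<close> (for \<open>b \<noteq> 0\<close>).\<close>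

definition rescale :: "'f::field \<Rightarrow> 'f \<Rightarrow> 'f E2 \<Rightarrow> 'f E2" where
  "rescale a b =
     Poly_Mapping.mapp (\<lambda>k c. fps_const (b powi k) * (c oo (fps_const a * fps_X)))"

text \<open>
  \<open>C\<^sub>6 = {\<plusminus>1} \<times> \<bbbF>\<^sub>4\<^sup>\<times>\<close>. The signs are integers since \<open>1 \<noteq> -1\<close> in \<open>W(\<bbbF>\<^sub>4)\<close>; in \<open>'f\<close> they coincide.
\<close>

definition C6 :: "(int \<times> 'f::field) monoid" where
  "C6 = \<lparr>carrier = {1, -1}, monoid.mult = (*), one = 1\<rparr> \<times>\<times> \<lparr>carrier = UNIV - {0}, monoid.mult = (*), one = 1\<rparr>"

definition C2_in_C6 :: "(int \<times> 'f::field) set" where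
  "C2_in_C6 = {1, -1} \<times> {1}"

definition C3_in_C6 :: "(int \<times> 'f::field) set" where
  "C3_in_C6 = {1} \<times> (UNIV - {0})"

text \<open>
  With \<open>\<zeta>\<close> a generator of \<open>\<bbbF>\<^sub>4\<^sup>\<times>\<close>, the element \<open>\<plusminus>\<zeta>\<^sup>n\<close> acts by \<open>u\<^sub>1 \<mapsto> \<omega>\<^sup>n u\<^sub>1\<close> and \<open>u \<mapsto> \<plusminus>\<omega>\<^sup>n u\<close>.
  The two cube roots of unity \<open>\<zeta>\<close> and \<open>\<omega>\<close> are not assumed to be equal.
\<close>

definition chi :: "'f::field \<Rightarrow> 'f \<Rightarrow> 'f \<Rightarrow> 'f" where
  "chi \<zeta> \<omega> x = \<omega> ^ (LEAST n. \<zeta> ^ n = x)"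

definition act :: "'f::field \<Rightarrow> 'f \<Rightarrow> int \<times> 'f \<Rightarrow> 'f E2 \<Rightarrow> 'f E2" where
  "act \<zeta> \<omega> g = rescale (chi \<zeta> \<omega> (snd g)) (of_int (fst g) * chi \<zeta> \<omega> (snd g))"

definition H_C6 :: "'f::field \<Rightarrow> 'f \<Rightarrow> ((int \<times> 'f) list \<Rightarrow> 'f E2) set ring" where
  "H_C6 \<zeta> \<omega> = cohomology_ring C6 (act \<zeta> \<omega>)"

definition H_C2 :: "'f::field \<Rightarrow> 'f \<Rightarrow> ((int \<times> 'f) list \<Rightarrow> 'f E2) set ring" where
  "H_C2 \<zeta> \<omega> = cohomology_ring (C6\<lparr>carrier := C2_in_C6\<rparr>) (act \<zeta> \<omega>)"

definition res_C6_C2 ::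
    "'f::field \<Rightarrow> 'f \<Rightarrow> ((int \<times> 'f) list \<Rightarrow> 'f E2) set \<Rightarrow> ((int \<times> 'f) list \<Rightarrow> 'f E2) set" where
  "res_C6_C2 \<zeta> \<omega> = restriction C6 (act \<zeta> \<omega>) C2_in_C6"

definition H_C2_C3_invariants :: "'f::field \<Rightarrow> 'f \<Rightarrow> ((int \<times> 'f) list \<Rightarrow> 'f E2) set set" where
  "H_C2_C3_invariants \<zeta> \<omega> = residual_invariants C6 (act \<zeta> \<omega>) C2_in_C6 C3_in_C6"

text \<open>\<open>E\<^sub>*/2\<close> is \<open>C\<^sub>2\<close>-invariant, so each of its elements defines a class in degree 0.\<close>

definition coef :: "'f::field \<Rightarrow> 'f \<Rightarrow> 'f E2 \<Rightarrow> ((int \<times> 'f) list \<Rightarrow> 'f E2) set" where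
  "coef \<zeta> \<omega> a =
     cohomology_class (C6\<lparr>carrier := C2_in_C6\<rparr>) (act \<zeta> \<omega>) (const_cochain (C6\<lparr>carrier := C2_in_C6\<rparr>) a)"

text \<open>
  The generator of \<open>H\<^sup>1(C\<^sub>2, \<int>[sgn])\<close> is represented by the homogeneous cocycle
  \<open>(g\<^sub>0, g\<^sub>1) \<mapsto> (g\<^sub>0 - g\<^sub>1)/2\<close>, the coboundary (up to sign) of the rational cochain \<open>g \<mapsto> g/2\<close>;
  in inhomogeneous terms it is \<open>1 \<mapsto> 0\<close>, \<open>-1 \<mapsto> 1\<close>. The class \<open>\<alpha>\<close> is its image under
  \<open>n \<mapsto> n u\<inverse>\<close>, reduced mod 2.
\<close>

definition alpha_cocycle :: "(int \<times> 'f::field) list \<Rightarrow> 'f E2" where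
  "alpha_cocycle xs =
     (if length xs = 2 \<and> set xs \<subseteq> C2_in_C6
      then of_int ((fst (xs ! 0) - fst (xs ! 1)) div 2) * u_pow (-1) else 0)"

definition alpha :: "'f::field \<Rightarrow> 'f \<Rightarrow> ((int \<times> 'f) list \<Rightarrow> 'f E2) set" where
  "alpha \<zeta> \<omega> = cohomology_class (C6\<lparr>carrier := C2_in_C6\<rparr>) (act \<zeta> \<omega>) alpha_cocycle"

text \<open>The map \<open>(E\<^sub>*/2)[\<alpha>] \<rightarrow> H\<^sup>*(C\<^sub>2, E\<^sub>*/2)\<close>.\<close>

definition eval_alpha :: "'f::field \<Rightarrow> 'f \<Rightarrow> 'f E2 poly \<Rightarrow> ((int \<times> 'f) list \<Rightarrow> 'f E2) set" where
  "eval_alpha \<zeta> \<omega> p =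
     (\<Oplus>\<^bsub>H_C2 \<zeta> \<omega>\<^esub> i\<in>{..Polynomial.degree p}.
        coef \<zeta> \<omega> (Polynomial.coeff p i) \<otimes>\<^bsub>H_C2 \<zeta> \<omega>\<^esub> alpha \<zeta> \<omega> [^]\<^bsub>H_C2 \<zeta> \<omega>\<^esub> i)"

definition w_class :: "'f::field \<Rightarrow> 'f \<Rightarrow> ((int \<times> 'f) list \<Rightarrow> 'f E2) set" where
  "w_class \<zeta> \<omega> = alpha \<zeta> \<omega> \<otimes>\<^bsub>H_C2 \<zeta> \<omega>\<^esub> coef \<zeta> \<omega> (u_pow (-2))"

end

theory Submission
  imports Defs
begin

text \<open>
  The ring \<open>E\<^sub>*/2\<close> has characteristic two, so averaging over \<open>C\<^sub>3\<close> (of odd order) needs no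
  denominators: composing a cochain on \<open>C\<^sub>2\<close> with the projection \<open>C\<^sub>6 \<rightarrow> C\<^sub>2\<close> and summing over
  \<open>C\<^sub>3\<close> is inverse, up to prism homotopies, to restriction onto the invariants.
  The action of \<open>C\<^sub>2\<close> is trivial, and the polynomial \<open>\<Sum> a\<^sub>n \<alpha>\<^sup>n\<close> is represented by the cocycle
  with value \<open>a\<^sub>n u\<^sup>-\<^sup>n\<close> on alternating lists of length \<open>n + 1\<close> and \<open>0\<close> on all other lists; this gives
  \<open>(E\<^sub>*/2)[\<alpha>] \<cong> H\<^sup>*(C\<^sub>2, E\<^sub>*/2)\<close>. A monomial \<open>u\<^sub>1\<^sup>j u\<^sup>k \<alpha>\<^sup>n\<close> is invariant iff
  \<open>j + k - n\<close> is divisible by 3, and then it is a product of the given generators.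
\<close>

section \<open>Cocycles in characteristic two\<close>

text \<open>Descent to C_2 meets an obstacle: for k in C_3 the map sending x to
  \<open>k \<otimes> \<pi> x\<close> is not equivariant, since a translation of C_6 with
  C_3-component c turns the map for k into the map for c^-1 k. Only the sum of the prisms over C_3
  is an equivariant homotopy, and as C_3 has odd order, the sum of |C_3| copies of f is f again. For
  C_2, the operator \<open>contract\<close> commutes with the differential and divides by alpha: it
  moves the coefficient of alpha^n to alpha^(n-1), up to the unit u^-1. Both the independence of the
  powers of alpha and the fact that they exhaust the cohomology then follow by induction on the
  degree. As alpha transforms like u^-1, the term a alpha^n is invariant exactly when a u^-n is;
  multiplying the latter by u^(3n) gives the coefficient of w^n. Without signs to track, the
  differential and the cup product become plain recursions on lists in which an entry is prepended
  to the argument. Prepending destroys equivariance, so the identities are proved for arbitrary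
  functions on lists and only then specialised to cochains.\<close>

fun omit_sum :: "('g list \<Rightarrow> 'm) \<Rightarrow> 'g list \<Rightarrow> 'm::comm_ring_1" where
  "omit_sum f [] = 0"
| "omit_sum f (x # xs) = f xs + omit_sum (\<lambda>ys. f (x # ys)) xs"

lemma omit_sum_add: "omit_sum (\<lambda>ys. f ys + g ys) xs = omit_sum f xs + omit_sum g xs"
  by (induction xs arbitrary: f g) (simp_all add: algebra_simps)

lemma omit_sum_mult: "omit_sum (\<lambda>ys. c * f ys) xs = c * omit_sum f xs"
  by (induction xs arbitrary: f) (simp_all add: algebra_simps)

lemma omit_sum_zero [simp]: "omit_sum (\<lambda>ys. 0) xs = 0"
  by (induction xs) simp_all

lemma omit_sum_map: "omit_sum (\<lambda>ys. f (map \<phi> ys)) xs = omit_sum f (map \<phi> xs)"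
  by (induction xs arbitrary: f) simp_all

text \<open>Faces are shorter by exactly one entry and use only entries of the original list. Hence
  cutting a function off outside a subset, or at a length that no face has, does not affect its
  differential.\<close>

lemma omit_sum_cong:
  assumes "\<And>ys. Suc (length ys) = length xs \<Longrightarrow> set ys \<subseteq> set xs \<Longrightarrow> f ys = g ys"
  shows "omit_sum f xs = omit_sum g xs"
  using assms
proof (induction xs arbitrary: f g)
  case (Cons x xs)
  have "omit_sum (\<lambda>ys. f (x # ys)) xs = omit_sum (\<lambda>ys. g (x # ys)) xs"
    by (intro Cons.IH Cons.prems) auto
  moreover have "f xs = g xs"
    using Cons.prems by auto
  ultimately show ?case by simp
qed simp

lemma omit_sum_sum: "omit_sum (\<lambda>ys. \<Sum>k\<in>K. f k ys) xs = (\<Sum>k\<in>K. omit_sum (f k) xs)"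
  by (induction xs arbitrary: f) (simp_all add: sum.distrib)

lemma omit_sum_hom:
  assumes "\<And>a b. h (a + b) = h a + h b" "h 0 = 0"
  shows "omit_sum (\<lambda>ys. h (f ys)) xs = h (omit_sum f xs)"
  by (induction xs arbitrary: f) (simp_all add: assms)

section \<open>The cup product as a recursion on lists\<close>

lemma cup_Nil [simp]: "cup f h [] = 0"
  by (simp add: cup_def)

lemma cup_Cons [simp]: "cup f h (x # xs) = f [x] * h (x # xs) + cup (\<lambda>ys. f (x # ys)) h xs"
  by (simp add: cup_def sum.lessThan_Suc_shift del: sum.lessThan_Suc)

lemma cup_add_left: "cup (\<lambda>ys. f ys + g ys) h xs = cup f h xs + cup g h xs"
  by (simp add: cup_def algebra_simps sum.distrib)

lemma cup_add_right: "cup h (\<lambda>ys. f ys + g ys) xs = cup h f xs + cup h g xs"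
  by (simp add: cup_def algebra_simps sum.distrib)

lemma cup_mult_left: "cup (\<lambda>ys. c * f ys) h xs = c * cup f h xs"
  by (simp add: cup_def algebra_simps sum_distrib_left)

lemma cup_zero [simp]: "cup (\<lambda>ys. 0) h xs = 0" "cup h (\<lambda>ys. 0) xs = 0"
  by (simp_all add: cup_def)

lemma cup_assoc: "cup (cup f g) h xs = cup f (cup g h) xs"
proof (induction xs arbitrary: f g)
  case (Cons x xs)
  show ?case
    by (simp add: cup_add_left cup_mult_left Cons algebra_simps)
qed simp

lemma cup_map: "cup f h (map \<phi> xs) = cup (\<lambda>ys. f (map \<phi> ys)) (\<lambda>ys. h (map \<phi> ys)) xs"
  by (simp add: cup_def take_map drop_map)

lemma cup_hom:
  assumes "\<And>a b. h (a + b) = h a + h b" "h 0 = 0" "\<And>a b. h (a * b) = h a * h b"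
  shows "cup (\<lambda>ys. h (f ys)) (\<lambda>ys. h (g ys)) xs = h (cup f g xs)"
  by (induction xs arbitrary: f) (simp_all add: assms)

lemma cup_cong:
  assumes "\<And>ys. set ys \<subseteq> set xs \<Longrightarrow> f ys = f' ys" "\<And>ys. set ys \<subseteq> set xs \<Longrightarrow> h ys = h' ys"
  shows "cup f h xs = cup f' h' xs"
  unfolding cup_def using assms by (intro sum.cong) (simp_all add: set_take_subset set_drop_subset)

text \<open>For arguments by support and degree: the two pieces of a list share the entry at which
  it is cut, hence the \<open>Suc\<close> in the length condition.\<close>

lemma cup_eq_0I:
  assumes "\<And>ys zs. f ys \<noteq> 0 \<Longrightarrow> h zs \<noteq> 0 \<Longrightarrow> ys \<noteq> [] \<Longrightarrow> zs \<noteq> [] \<Longrightarrow>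
    length ys + length zs = Suc (length xs) \<Longrightarrow> set xs = set ys \<union> set zs \<Longrightarrow> False"
  shows "cup f h xs = 0"
proof -
  have "f (take (Suc p) xs) * h (drop p xs) = 0" if p: "p < length xs" for p
  proof (rule ccontr)
    assume "f (take (Suc p) xs) * h (drop p xs) \<noteq> 0"
    then have "f (take (Suc p) xs) \<noteq> 0" "h (drop p xs) \<noteq> 0" by auto
    moreover have "set xs = set (take (Suc p) xs) \<union> set (drop p xs)"
    proof -
      have "set xs = set (take (Suc p) xs) \<union> set (drop (Suc p) xs)"
        by (metis append_take_drop_id set_append)
      moreover have "set (drop (Suc p) xs) \<subseteq> set (drop p xs)"
        by (simp add: set_drop_subset_set_drop)
      ultimately show ?thesis
        using set_drop_subset[of p xs] by blast
    qed
    ultimately show False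
      using assms[of "take (Suc p) xs" "drop p xs"] p by fastforce
  qed
  then show ?thesis by (simp add: cup_def)
qed

section \<open>Prism operators: homotopies between a function on lists and its pullback along a
  map\<close>

fun prism :: "('g \<Rightarrow> 'g) \<Rightarrow> ('g list \<Rightarrow> 'm) \<Rightarrow> 'g list \<Rightarrow> 'm::comm_ring_1" where
  "prism \<phi> f [] = 0"
| "prism \<phi> f (x # xs) = f (x # \<phi> x # map \<phi> xs) + prism \<phi> (\<lambda>ys. f (x # ys)) xs"

lemma prism_add: "prism \<phi> (\<lambda>ys. f ys + g ys) xs = prism \<phi> f xs + prism \<phi> g xs"
  by (induction xs arbitrary: f g) (simp_all add: algebra_simps)

lemma prism_cong:
  assumes "\<And>ys. length ys = Suc (length xs) \<Longrightarrow> set ys \<subseteq> set xs \<union> \<phi> ` set xs \<Longrightarrow> f ys = g ys"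
  shows "prism \<phi> f xs = prism \<phi> g xs"
  using assms
proof (induction xs arbitrary: f g)
  case (Cons x xs)
  have "prism \<phi> (\<lambda>ys. f (x # ys)) xs = prism \<phi> (\<lambda>ys. g (x # ys)) xs"
    by (intro Cons.IH Cons.prems) auto
  moreover have "f (x # \<phi> x # map \<phi> xs) = g (x # \<phi> x # map \<phi> xs)"
    by (intro Cons.prems) auto
  ultimately show ?case by simp
qed simp

lemma prism_hom:
  assumes "\<And>a b. h (a + b) = h a + h b" "h 0 = 0"
  shows "prism \<phi> (\<lambda>ys. h (f ys)) xs = h (prism \<phi> f xs)"
  by (induction xs arbitrary: f) (simp_all add: assms)

text \<open>Moving a translation \<open>\<tau>\<close> through a prism may replace the map
  \<open>\<phi>\<close> by another map \<open>\<psi>\<close>; this is how translations come to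
  permute a family of prisms.\<close>

lemma prism_map:
  assumes "\<And>x. x \<in> set xs \<Longrightarrow> \<phi> (\<tau> x) = \<tau> (\<psi> x)"
  shows "prism \<phi> f (map \<tau> xs) = prism \<psi> (\<lambda>ys. f (map \<tau> ys)) xs"
  using assms
proof (induction xs arbitrary: f)
  case (Cons x xs)
  have "map \<phi> (map \<tau> xs) = map \<tau> (map \<psi> xs)" using Cons.prems by simp
  then show ?case using Cons by (simp del: map_map)
qed simp

locale char2_action =
  fixes G :: "('g, 'b) monoid_scheme" (structure) and \<rho> :: "'g \<Rightarrow> 'm \<Rightarrow> 'm::comm_ring_1"
  assumes closed: "x \<in> carrier G \<Longrightarrow> y \<in> carrier G \<Longrightarrow> x \<otimes> y \<in> carrier G"
    and act_add: "g \<in> carrier G \<Longrightarrow> \<rho> g (a + b) = \<rho> g a + \<rho> g b"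
    and act_mult: "g \<in> carrier G \<Longrightarrow> \<rho> g (a * b) = \<rho> g a * \<rho> g b"
    and act_one: "g \<in> carrier G \<Longrightarrow> \<rho> g 1 = 1"
    and double: "a + a = (0::'m)"
begin

lemma double' [simp]: "a + (a + b) = (b::'m)"
  by (simp add: double flip: add.assoc)

lemma two_eq_0 [simp]: "2 = (0::'m)"
  using double[of 1] by simp

lemma uminus_eq: "- a = (a::'m)"
  using double by (simp add: neg_eq_iff_add_eq_0)

lemma act_zero: "g \<in> carrier G \<Longrightarrow> \<rho> g 0 = 0"
  using act_add[of g 0 0] by simp

lemma coboundary_eq: "coboundary G f xs = (if set xs \<subseteq> carrier G then omit_sum f xs else (0::'m))"
proof -
  have sign: "(- 1) ^ i = (1::'m)" for i
    by (induction i) (simp_all add: uminus_eq del: mult_minus1)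
  have "(\<Sum>i<length xs. f (take i xs @ drop (Suc i) xs)) = omit_sum f xs"
    by (induction xs arbitrary: f) (simp_all add: sum.lessThan_Suc_shift del: sum.lessThan_Suc)
  then show ?thesis unfolding coboundary_def sign by simp
qed

lemma omit_sum_omit_sum: "omit_sum (omit_sum f) xs = (0::'m)"
  by (induction xs arbitrary: f) (simp_all add: omit_sum_add)

text \<open>Omitting the shared entry yields the products f(x_0, ..., x_(p-1)) h(x_p, ..., x_n) of
  disjoint pieces once from each cup product on the right, and these cancel. The two products with
  an empty piece have no partner; the last two summands cancel them, and they vanish for
  cochains.\<close>

lemma omit_sum_cup:
  "omit_sum (cup f h) xs =
     cup (omit_sum f) h xs + cup f (omit_sum h) xs + f [] * h xs + f xs * (h [] :: 'm)"
proof (induction xs arbitrary: f)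
  case Nil
  show ?case by (simp add: double)
next
  case (Cons x xs)
  show ?case
    by (simp add: omit_sum_add omit_sum_mult Cons cup_add_left distrib_left distrib_right
        add.assoc add.commute add.left_commute double)
qed

text \<open>The usual telescoping: omitting \<open>\<phi>\<close> x_i from the i-th prism summand
  gives the same list as omitting x_(i+1) from the next one. Only the two ends survive, where all
  entries or none have been mapped.\<close>

lemma omit_sum_prism:
  fixes f :: "'g list \<Rightarrow> 'm"
  shows "omit_sum (prism \<phi> f) xs + prism \<phi> (omit_sum f) xs = f xs + f (map \<phi> xs)"
proof (induction xs arbitrary: f)
  case Nil
  show ?case by (simp add: double)
next
  case (Cons x xs)
  let ?s = "\<lambda>ys. f (x # ys)"
  have "omit_sum (prism \<phi> f) (x # xs) + prism \<phi> (omit_sum f) (x # xs) =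
     (omit_sum (prism \<phi> ?s) xs + prism \<phi> (omit_sum ?s) xs) + f (x # map \<phi> xs) + f (\<phi> x # map \<phi> xs)"
    by (simp add: omit_sum_add omit_sum_map[of "\<lambda>ys. f (x # \<phi> x # ys)"] prism_add
        add.assoc add.commute add.left_commute double)
  then show ?case
    by (simp add: Cons add.assoc add.commute add.left_commute double)
qed

section \<open>The cochain complex and its products\<close>

lemma cochainsI:
  assumes "\<And>xs. f xs \<noteq> 0 \<Longrightarrow> xs \<noteq> [] \<and> set xs \<subseteq> carrier G"
    and "\<And>xs. length xs > N \<Longrightarrow> f xs = 0"
    and "\<And>g xs. g \<in> carrier G \<Longrightarrow> set xs \<subseteq> carrier G \<Longrightarrow> xs \<noteq> [] \<Longrightarrow>
      f (map (\<lambda>x. g \<otimes> x) xs) = \<rho> g (f xs)"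
  shows "f \<in> cochains G \<rho>"
proof -
  have "f [] = 0" using assms(1) by auto
  then have "f (map (\<lambda>x. g \<otimes> x) xs) = \<rho> g (f xs)" if "g \<in> carrier G" "xs \<in> lists (carrier G)" for g xs
    using assms(3)[of g xs] that by (cases "xs = []") (auto simp: act_zero)
  then show ?thesis unfolding cochains_def using assms(1,2) by blast
qed

lemma cochains_Nil: "f \<in> cochains G \<rho> \<Longrightarrow> f [] = 0"
  unfolding cochains_def by auto

lemma cochains_out: "f \<in> cochains G \<rho> \<Longrightarrow> \<not> set xs \<subseteq> carrier G \<Longrightarrow> f xs = 0"
  unfolding cochains_def by auto

lemma cochains_bound: "f \<in> cochains G \<rho> \<Longrightarrow> \<exists>N. \<forall>xs. length xs > N \<longrightarrow> f xs = 0"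
  unfolding cochains_def by auto

lemma cochains_act:
  "f \<in> cochains G \<rho> \<Longrightarrow> g \<in> carrier G \<Longrightarrow> set xs \<subseteq> carrier G \<Longrightarrow>
     f (map (\<lambda>x. g \<otimes> x) xs) = \<rho> g (f xs)"
  unfolding cochains_def by (auto simp: lists_eq_set)

lemma set_translate: "g \<in> carrier G \<Longrightarrow> set xs \<subseteq> carrier G \<Longrightarrow> set (map (\<lambda>x. g \<otimes> x) xs) \<subseteq> carrier G"
  using closed by auto

lemma zero_cochain: "(\<lambda>_. 0) \<in> cochains G \<rho>"
  by (rule cochainsI) (auto simp: act_zero)

lemma add_cochain:
  assumes "f \<in> cochains G \<rho>" "h \<in> cochains G \<rho>"
  shows "(\<lambda>xs. f xs + h xs) \<in> cochains G \<rho>"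
proof -
  obtain M N where "\<forall>xs. length xs > M \<longrightarrow> f xs = 0" "\<forall>xs. length xs > N \<longrightarrow> h xs = 0"
    using cochains_bound assms by metis
  then show ?thesis
    using cochains_Nil[OF assms(1)] cochains_Nil[OF assms(2)] cochains_out[OF assms(1)]
      cochains_out[OF assms(2)] cochains_act[OF assms(1)] cochains_act[OF assms(2)]
    by (intro cochainsI[where N = "max M N"]) (auto simp: act_add, fastforce)
qed

lemma coboundary_cochain:
  assumes "f \<in> cochains G \<rho>"
  shows "coboundary G f \<in> cochains G \<rho>"
proof -
  obtain N where N: "\<forall>xs. length xs > N \<longrightarrow> f xs = 0"
    using cochains_bound assms by metis
  show ?thesis
  proof (rule cochainsI[where N = "Suc N"])
    fix xs :: "'g list" assume "length xs > Suc N"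
    then have "omit_sum f xs = omit_sum (\<lambda>_. 0) xs"
      using N by (intro omit_sum_cong) auto
    then show "coboundary G f xs = 0" by (simp add: coboundary_eq)
  next
    fix g and xs :: "'g list" assume *: "g \<in> carrier G" "set xs \<subseteq> carrier G"
    have "omit_sum f (map (\<lambda>x. g \<otimes> x) xs) = omit_sum (\<lambda>ys. f (map (\<lambda>x. g \<otimes> x) ys)) xs"
      by (simp add: omit_sum_map)
    also have "\<dots> = omit_sum (\<lambda>ys. \<rho> g (f ys)) xs"
      using * assms by (intro omit_sum_cong cochains_act) auto
    also have "\<dots> = \<rho> g (omit_sum f xs)"
      using * by (intro omit_sum_hom) (simp_all add: act_add act_zero)
    finally show "coboundary G f (map (\<lambda>x. g \<otimes> x) xs) = \<rho> g (coboundary G f xs)"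
      using * set_translate[OF *] by (simp add: coboundary_eq)
  qed (auto simp: coboundary_eq split: if_splits)
qed

lemma cup_cochain:
  assumes f: "f \<in> cochains G \<rho>" and h: "h \<in> cochains G \<rho>"
  shows "cup f h \<in> cochains G \<rho>"
proof -
  obtain M N where N: "\<forall>xs. length xs > M \<longrightarrow> f xs = 0" "\<forall>xs. length xs > N \<longrightarrow> h xs = 0"
    using cochains_bound assms by metis
  show ?thesis
  proof (rule cochainsI[where N = "M + N"])
    fix xs :: "'g list" assume "length xs > M + N"
    then show "cup f h xs = 0"
    proof (intro cup_eq_0I)
      fix ys zs assume "f ys \<noteq> 0" "h zs \<noteq> 0" and l: "length ys + length zs = Suc (length xs)"
      then have "length ys \<le> M" "length zs \<le> N" using N by (meson not_le)+
      then show False using l \<open>length xs > M + N\<close> by simp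
    qed
  next
    fix xs :: "'g list" assume "cup f h xs \<noteq> 0"
    moreover have "cup f h xs = 0" if "\<not> set xs \<subseteq> carrier G"
    proof (rule cup_eq_0I)
      fix ys zs assume "f ys \<noteq> 0" "h zs \<noteq> 0" "set xs = set ys \<union> set zs"
      moreover from this have "set ys \<subseteq> carrier G" "set zs \<subseteq> carrier G"
        using cochains_out f h by metis+
      ultimately show False using that by simp
    qed
    ultimately show "xs \<noteq> [] \<and> set xs \<subseteq> carrier G" by auto
  next
    fix g and xs :: "'g list" assume *: "g \<in> carrier G" "set xs \<subseteq> carrier G"
    have "cup f h (map (\<lambda>x. g \<otimes> x) xs) =
        cup (\<lambda>ys. f (map (\<lambda>x. g \<otimes> x) ys)) (\<lambda>ys. h (map (\<lambda>x. g \<otimes> x) ys)) xs"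
      by (simp add: cup_map)
    also have "\<dots> = cup (\<lambda>ys. \<rho> g (f ys)) (\<lambda>ys. \<rho> g (h ys)) xs"
      using * assms by (intro cup_cong cochains_act) auto
    also have "\<dots> = \<rho> g (cup f h xs)"
      using * by (intro cup_hom) (simp_all add: act_add act_zero act_mult)
    finally show "cup f h (map (\<lambda>x. g \<otimes> x) xs) = \<rho> g (cup f h xs)" .
  qed
qed

lemma coboundary_add:
  "coboundary G (\<lambda>xs. f xs + h xs) = (\<lambda>xs. coboundary G f xs + coboundary G h xs :: 'm)"
  by (auto simp: coboundary_eq omit_sum_add)

lemma coboundary_cup:
  assumes f: "f \<in> cochains G \<rho>" and h: "h \<in> cochains G \<rho>"
  shows "coboundary G (cup f h) = (\<lambda>xs. cup (coboundary G f) h xs + cup f (coboundary G h) xs)"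
proof
  fix xs
  show "coboundary G (cup f h) xs = cup (coboundary G f) h xs + cup f (coboundary G h) xs"
  proof (cases "set xs \<subseteq> carrier G")
    case True
    then have "cup (coboundary G f) h xs = cup (omit_sum f) h xs"
      "cup f (coboundary G h) xs = cup f (omit_sum h) xs"
      by (auto intro!: cup_cong simp: coboundary_eq)
    then show ?thesis
      using True by (simp add: coboundary_eq omit_sum_cup cochains_Nil f h)
  next
    case False
    then show ?thesis
      using cochains_out[OF cup_cochain[OF coboundary_cochain[OF f] h]]
        cochains_out[OF cup_cochain[OF f coboundary_cochain[OF h]]]
      by (simp add: coboundary_eq)
  qed
qed

lemma coboundary_coboundary: "coboundary G (coboundary G f) = (\<lambda>_. 0::'m)"
proof
  fix xs
  have "omit_sum (coboundary G f) xs = omit_sum (omit_sum f) xs" if "set xs \<subseteq> carrier G"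
    using that by (intro omit_sum_cong) (auto simp: coboundary_eq)
  then show "coboundary G (coboundary G f) xs = 0"
    by (simp add: coboundary_eq[of "coboundary G f"] omit_sum_omit_sum)
qed

lemma const_cochain_cochain:
  assumes "\<And>g. g \<in> carrier G \<Longrightarrow> \<rho> g a = a"
  shows "const_cochain G a \<in> cochains G \<rho>"
proof (rule cochainsI[where N = 1])
  fix g and xs :: "'g list" assume *: "g \<in> carrier G" "set xs \<subseteq> carrier G"
  then show "const_cochain G a (map (\<lambda>x. g \<otimes> x) xs) = \<rho> g (const_cochain G a xs)"
    using set_translate[OF *] assms by (simp add: const_cochain_def act_zero)
qed (auto simp: const_cochain_def split: if_splits)

lemma coboundary_const_cochain: "coboundary G (const_cochain G a) = (\<lambda>_. 0::'m)"
proof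
  fix xs
  show "coboundary G (const_cochain G a) xs = 0"
  proof (cases "length xs = 2 \<and> set xs \<subseteq> carrier G")
    case True
    then obtain x y where "xs = [x, y]"
      by (auto simp: length_Suc_conv numeral_2_eq_2)
    then show ?thesis using True by (simp add: coboundary_eq const_cochain_def double)
  next
    case False
    then have "omit_sum (const_cochain G a) xs = omit_sum (\<lambda>_. 0) xs" if "set xs \<subseteq> carrier G"
      using that by (intro omit_sum_cong) (auto simp: const_cochain_def)
    then show ?thesis by (simp add: coboundary_eq)
  qed
qed

lemma cup_const_left:
  assumes "f \<in> cochains G \<rho>"
  shows "cup (const_cochain G a) f xs = a * f xs"
proof (cases xs)
  case Nil
  then show ?thesis by (simp add: cochains_Nil[OF assms])
next
  case (Cons x ys)
  have "cup (\<lambda>ys. const_cochain G a (x # ys)) f ys = 0"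
    by (rule cup_eq_0I) (auto simp: const_cochain_def)
  then show ?thesis
    using cochains_out[OF assms, of "x # ys"] by (simp add: Cons const_cochain_def)
qed

lemma cup_const_right:
  assumes "f \<in> cochains G \<rho>"
  shows "cup f (const_cochain G a) xs = a * f xs"
proof -
  \<comment> \<open>Generalised beyond cochains, because the induction prepends an entry to the
    argument of f and thereby loses equivariance.\<close>
  have *: "cup f (const_cochain G a) xs = (if set xs \<subseteq> carrier G then a * f xs else 0)"
    if "f [] = 0" "\<And>ys. \<not> set ys \<subseteq> carrier G \<Longrightarrow> f ys = 0" for f xs
  proof (cases "set xs \<subseteq> carrier G")
    case True
    then show ?thesis using that(1)
    proof (induction xs arbitrary: f)
      case (Cons x xs)
      show ?case
      proof (cases xs)
        case Nil
        then show ?thesis using Cons.prems by (simp add: const_cochain_def)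
      next
        case (Cons y zs)
        then have "cup f (const_cochain G a) (x # xs) = cup (\<lambda>ys. f (x # ys)) (const_cochain G a) xs"
          by (simp add: const_cochain_def)
        \<comment> \<open>After prepending x the value at the empty list is f [x], but the induction
          hypothesis asks for 0. A cup product never evaluates its left factor at the empty list, so
          this value can be reset.\<close>
        also have "\<dots> = cup (\<lambda>ys. if ys = [] then 0 else f (x # ys)) (const_cochain G a) xs"
          by (simp add: cup_def Cons)
        also have "\<dots> = a * f (x # xs)"
          using Cons.IH[of "\<lambda>ys. if ys = [] then 0 else f (x # ys)"] Cons.prems Cons by simp
        finally show ?thesis using Cons.prems by simp
      qed
    qed simp
  next
    case False
    have "cup f (const_cochain G a) xs = 0"
      using that False
      by (intro cup_eq_0I) (metis Un_least const_cochain_def)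
    then show ?thesis using False by simp
  qed
  show ?thesis
    using *[of f xs] cochains_Nil[OF assms] cochains_out[OF assms] by auto
qed

section \<open>Cocycles modulo coboundaries as a ring\<close>

abbreviation "Z \<equiv> cocycle_ring G \<rho>"
abbreviation "B \<equiv> coboundary G ` cochains G \<rho>"

lemma cocycle_simps [simp]:
  "monoid.mult Z = cup" "one Z = const_cochain G 1" "zero Z = (\<lambda>_. 0)" "add Z = (\<lambda>f h xs. f xs + h xs)"
  by (simp_all add: cocycle_ring_def)

lemma in_cocycles: "f \<in> carrier Z \<longleftrightarrow> f \<in> cochains G \<rho> \<and> coboundary G f = (\<lambda>_. 0)"
  by (simp add: cocycle_ring_def)

lemma cocycles_cochain: "f \<in> carrier Z \<Longrightarrow> f \<in> cochains G \<rho>"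
  by (simp add: in_cocycles)

lemma const_cocycle: "(\<And>g. g \<in> carrier G \<Longrightarrow> \<rho> g a = a) \<Longrightarrow> const_cochain G a \<in> carrier Z"
  by (simp add: in_cocycles const_cochain_cochain coboundary_const_cochain)

lemma add_cocycle: "f \<in> carrier Z \<Longrightarrow> h \<in> carrier Z \<Longrightarrow> (\<lambda>xs. f xs + h xs) \<in> carrier Z"
  by (simp add: in_cocycles add_cochain coboundary_add)

lemma cup_cocycle: "f \<in> carrier Z \<Longrightarrow> h \<in> carrier Z \<Longrightarrow> cup f h \<in> carrier Z"
  by (simp add: in_cocycles cup_cochain coboundary_cup)

lemma coboundary_cocycle: "f \<in> B \<Longrightarrow> f \<in> carrier Z"
  using coboundary_cochain coboundary_coboundary by (auto simp: in_cocycles)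

lemma ring_Z: "ring Z"
proof (rule ringI)
  show "abelian_group Z"
  proof (rule abelian_groupI)
    fix f assume f: "f \<in> carrier Z"
    then show "\<exists>g\<in>carrier Z. g \<oplus>\<^bsub>Z\<^esub> f = \<zero>\<^bsub>Z\<^esub>"
      by (intro bexI[of _ f]) (simp_all add: double)
  qed (auto simp: add_cocycle in_cocycles[of "\<lambda>_. 0"] zero_cochain coboundary_eq algebra_simps)
  show "Group.monoid Z"
  proof (rule monoidI)
    fix f g h
    show "f \<otimes>\<^bsub>Z\<^esub> g \<otimes>\<^bsub>Z\<^esub> h = f \<otimes>\<^bsub>Z\<^esub> (g \<otimes>\<^bsub>Z\<^esub> h)"
      by (auto simp: fun_eq_iff cup_assoc)
  qed (auto simp: cup_cocycle const_cocycle act_one cup_const_left cup_const_right cocycles_cochain)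
qed (auto simp: cup_add_left cup_add_right)

lemma ideal_B: "ideal B Z"
proof (rule idealI[OF ring_Z])
  interpret R: ring Z by (rule ring_Z)
  have zero: "(\<lambda>_. 0) \<in> B"
    using zero_cochain by (intro image_eqI[of _ _ "\<lambda>_. 0"]) (auto simp: coboundary_eq)
  have inv: "\<ominus>\<^bsub>Z\<^esub> f = f" if "f \<in> carrier Z" for f
    using that by (intro R.minus_equality) (auto simp: double)
  show "subgroup B (add_monoid Z)"
  proof (rule group.subgroupI[OF R.a_group])
    show "B \<subseteq> carrier (add_monoid Z)" using coboundary_cocycle by auto
    show "B \<noteq> {}" using zero by auto
    fix a b assume a: "a \<in> B"
    show "inv\<^bsub>add_monoid Z\<^esub> a \<in> B"
      using inv[OF coboundary_cocycle[OF a]] a by (simp add: a_inv_def)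
    assume "b \<in> B"
    then obtain f h where "f \<in> cochains G \<rho>" "h \<in> cochains G \<rho>" "a = coboundary G f" "b = coboundary G h"
      using a by auto
    then show "a \<otimes>\<^bsub>add_monoid Z\<^esub> b \<in> B"
      using add_cochain coboundary_add by (intro image_eqI[of _ _ "\<lambda>xs. f xs + h xs"]) auto
  qed
  fix a x assume "a \<in> B" "x \<in> carrier Z"
  then obtain f where f: "f \<in> cochains G \<rho>" "a = coboundary G f" "x \<in> cochains G \<rho>"
    "coboundary G x = (\<lambda>_. 0)" by (auto simp: in_cocycles)
  \<comment> \<open>By the Leibniz rule, a cocycle times the coboundary of f is the coboundary of
    its product with f.\<close>
  show "x \<otimes>\<^bsub>Z\<^esub> a \<in> B"
    using f by (intro image_eqI[of _ _ "cup x f"]) (auto simp: coboundary_cup cup_cochain)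
  show "a \<otimes>\<^bsub>Z\<^esub> x \<in> B"
    using f by (intro image_eqI[of _ _ "cup f x"]) (auto simp: coboundary_cup cup_cochain)
qed

abbreviation "cls \<equiv> cohomology_class G \<rho>"

lemma cohomology_ring: "ring (cohomology_ring G \<rho>)"
  unfolding cohomology_ring_def by (rule ideal.quotient_is_ring[OF ideal_B])

lemma cls_hom: "cls \<in> ring_hom Z (cohomology_ring G \<rho>)"
  unfolding cohomology_ring_def cohomology_class_def[abs_def] by (rule ideal.rcos_ring_hom[OF ideal_B])

lemma carrier_cohomology: "carrier (cohomology_ring G \<rho>) = cls ` carrier Z"
  by (auto simp: cohomology_ring_def FactRing_def A_RCOSETS_def' cohomology_class_def a_r_coset_def
      RCOSETS_def r_coset_def)

lemma cls_mem: "h \<in> cls f \<longleftrightarrow> (\<exists>b\<in>B. h = (\<lambda>xs. b xs + f xs))"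
  by (auto simp: cohomology_class_def a_r_coset_def' )

lemma cls_self: "f \<in> carrier Z \<Longrightarrow> f \<in> cls f"
proof -
  interpret I: ideal B Z by (rule ideal_B)
  show "f \<in> carrier Z \<Longrightarrow> f \<in> cls f"
    using I.a_rcos_self by (simp add: cohomology_class_def)
qed

lemma cls_eq_iff:
  assumes "f \<in> carrier Z" "h \<in> carrier Z"
  shows "cls f = cls h \<longleftrightarrow> (\<exists>k\<in>cochains G \<rho>. \<forall>xs. f xs + h xs = coboundary G k xs)"
proof -
  interpret I: ideal B Z by (rule ideal_B)
  have "cls f = cls h \<longleftrightarrow> f \<in> cls h"
    using cls_self[OF assms(1)] I.a_repr_independence'[of f h] assms
    by (auto simp: cohomology_class_def)
  also have "\<dots> \<longleftrightarrow> (\<exists>k\<in>cochains G \<rho>. f = (\<lambda>xs. coboundary G k xs + h xs))"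
    by (auto simp: cls_mem)
  also have "\<dots> \<longleftrightarrow> (\<exists>k\<in>cochains G \<rho>. \<forall>xs. f xs + h xs = coboundary G k xs)"
    by (metis (no_types, lifting) add.commute double')
  finally show ?thesis .
qed

end

section \<open>Restriction to a retract with kernel of odd order\<close>

context char2_action
begin

lemma sum_cochain:
  assumes "\<And>k. k \<in> K \<Longrightarrow> f k \<in> cochains G \<rho>"
  shows "(\<lambda>xs. \<Sum>k\<in>K. f k xs) \<in> cochains G \<rho>"
  using assms
proof (induction K rule: infinite_finite_induct)
  case (insert k K)
  then have "(\<lambda>xs. f k xs + (\<Sum>k\<in>K. f k xs)) \<in> cochains G \<rho>"
    by (intro add_cochain) auto
  then show ?case using insert.hyps by simp
qed (simp_all add: zero_cochain)

lemma coboundary_sum: "coboundary G (\<lambda>xs. \<Sum>k\<in>K. f k xs) xs = (\<Sum>k\<in>K. coboundary G (f k) xs :: 'm)"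
  by (simp add: coboundary_eq omit_sum_sum)

lemma act_sum: "g \<in> carrier G \<Longrightarrow> \<rho> g (\<Sum>k\<in>K. c k) = (\<Sum>k\<in>K. \<rho> g (c k))"
  by (induction K rule: infinite_finite_induct) (simp_all add: act_add act_zero)

text \<open>
  A single \<open>\<phi> k\<close> need not commute with translations; it is enough that translations
  permute the family.
\<close>

lemma prism_homotopy:
  fixes \<phi> :: "'k \<Rightarrow> 'g \<Rightarrow> 'g"
  assumes f: "f \<in> carrier Z"
    and closed': "\<And>k x. k \<in> K \<Longrightarrow> x \<in> carrier G \<Longrightarrow> \<phi> k x \<in> carrier G"
    and perm: "\<And>g. g \<in> carrier G \<Longrightarrow>
      \<exists>\<sigma>. bij_betw \<sigma> K K \<and> (\<forall>k\<in>K. \<forall>x\<in>carrier G. \<phi> k (g \<otimes> x) = g \<otimes> \<phi> (\<sigma> k) x)"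
  shows "\<exists>q\<in>cochains G \<rho>. \<forall>xs. set xs \<subseteq> carrier G \<longrightarrow>
    coboundary G q xs = (\<Sum>k\<in>K. f xs + f (map (\<phi> k) xs))"
proof -
  \<comment> \<open>Cut off outside the group: some prism summands see an entry of the list only
    through \<open>\<phi> k\<close>, which says nothing about whether the entry itself lies in the
    group.\<close>
  define p where "p k xs = (if set xs \<subseteq> carrier G then prism (\<phi> k) f xs else 0)" for k xs
  define q where "q xs = (\<Sum>k\<in>K. p k xs)" for xs
  have fc: "f \<in> cochains G \<rho>" and df: "coboundary G f = (\<lambda>_. 0)"
    using f by (simp_all add: in_cocycles)
  obtain N where N: "\<forall>xs. length xs > N \<longrightarrow> f xs = 0"
    using cochains_bound[OF fc] by blast
  have "q \<in> cochains G \<rho>"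
  proof (rule cochainsI[where N = N])
    fix xs assume "q xs \<noteq> 0"
    then obtain k where "p k xs \<noteq> 0"
      unfolding q_def by (meson sum.neutral)
    then show "xs \<noteq> [] \<and> set xs \<subseteq> carrier G"
      by (auto simp: p_def split: if_splits)
  next
    fix xs :: "'g list" assume xs: "length xs > N"
    have "prism (\<phi> k) f xs = 0" for k :: 'k
    proof -
      have "prism (\<phi> k) f xs = prism (\<phi> k) (\<lambda>_. 0) xs"
        using N xs by (intro prism_cong) auto
      also have "prism (\<phi> k) (\<lambda>_. 0) xs = (0::'m)"
        by (induction xs) simp_all
      finally show ?thesis .
    qed
    then have "p k xs = 0" for k by (simp add: p_def)
    then show "q xs = 0" by (simp add: q_def)
  next
    fix g and xs :: "'g list"
    assume g: "g \<in> carrier G" and xs: "set xs \<subseteq> carrier G"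
    obtain \<sigma> where \<sigma>: "bij_betw \<sigma> K K"
      "\<And>k x. k \<in> K \<Longrightarrow> x \<in> carrier G \<Longrightarrow> \<phi> k (g \<otimes> x) = g \<otimes> \<phi> (\<sigma> k) x"
      using perm[OF g] by blast
    have "p k (map (\<lambda>x. g \<otimes> x) xs) = \<rho> g (p (\<sigma> k) xs)" if k: "k \<in> K" for k
    proof -
      have "\<sigma> k \<in> K" using \<sigma>(1) k by (auto simp: bij_betw_def)
      have "prism (\<phi> k) f (map (\<lambda>x. g \<otimes> x) xs) =
          prism (\<phi> (\<sigma> k)) (\<lambda>ys. f (map (\<lambda>x. g \<otimes> x) ys)) xs"
        using \<sigma>(2)[OF k] xs by (intro prism_map) auto
      also have "\<dots> = prism (\<phi> (\<sigma> k)) (\<lambda>ys. \<rho> g (f ys)) xs"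
        using xs closed'[OF \<open>\<sigma> k \<in> K\<close>] by (intro prism_cong cochains_act[OF fc g]) blast
      also have "\<dots> = \<rho> g (prism (\<phi> (\<sigma> k)) f xs)"
        using g by (intro prism_hom) (simp_all add: act_add act_zero)
      finally show ?thesis
        using xs set_translate[OF g xs] by (simp add: p_def)
    qed
    then have "q (map (\<lambda>x. g \<otimes> x) xs) = (\<Sum>k\<in>K. \<rho> g (p (\<sigma> k) xs))"
      by (simp add: q_def)
    \<comment> \<open>Translation by g carries the prism for k to the one for
      \<open>\<sigma> k\<close>, so the total is merely reindexed.\<close>
    also have "\<dots> = (\<Sum>k\<in>K. \<rho> g (p k xs))"
      using sum.reindex_bij_betw[OF \<sigma>(1)] .
    finally show "q (map (\<lambda>x. g \<otimes> x) xs) = \<rho> g (q xs)"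
      using g by (simp add: q_def act_sum)
  qed
  moreover have "coboundary G q xs = (\<Sum>k\<in>K. f xs + f (map (\<phi> k) xs))" if xs: "set xs \<subseteq> carrier G" for xs
  proof -
    have "coboundary G (p k) xs = f xs + f (map (\<phi> k) xs)" if k: "k \<in> K" for k
    proof -
      have "omit_sum (p k) xs = omit_sum (prism (\<phi> k) f) xs"
        using xs by (intro omit_sum_cong) (auto simp: p_def)
      moreover have "prism (\<phi> k) (omit_sum f) xs = prism (\<phi> k) (\<lambda>_. 0) xs"
      proof (rule prism_cong)
        fix ys assume "set ys \<subseteq> set xs \<union> \<phi> k ` set xs"
        then have "set ys \<subseteq> carrier G" using xs closed'[OF k] by blast
        then show "omit_sum f ys = 0"
          using fun_cong[OF df, of ys] by (simp add: coboundary_eq)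
      qed
      moreover have "prism (\<phi> k) (\<lambda>_. 0) xs = (0::'m)"
        by (induction xs) simp_all
      ultimately show ?thesis
        using omit_sum_prism[of "\<phi> k" f xs] xs by (simp add: coboundary_eq)
    qed
    then show ?thesis by (simp add: q_def[abs_def] coboundary_sum)
  qed
  ultimately show ?thesis by blast
qed

end

text \<open>An internal splitting of an abelian group as H times K: \<open>\<pi>\<close> projects
  onto H with kernel K. The case of interest is C_6 with H = C_2 and K = C_3.\<close>

locale odd_retract = comm_group G + char2_action G \<rho>
  for G :: "('g, 'b) monoid_scheme" (structure) and \<rho> :: "'g \<Rightarrow> 'm \<Rightarrow> 'm::comm_ring_1" +
  fixes \<pi> :: "'g \<Rightarrow> 'g" and H K :: "'g set"
  assumes act_comp: "g \<in> carrier G \<Longrightarrow> h \<in> carrier G \<Longrightarrow> \<rho> (g \<otimes> h) a = \<rho> g (\<rho> h a)"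
    and H_sub: "H \<subseteq> carrier G" and K_sub: "K \<subseteq> carrier G"
    and pi_in: "x \<in> carrier G \<Longrightarrow> \<pi> x \<in> H"
    and pi_id: "x \<in> H \<Longrightarrow> \<pi> x = x"
    and pi_mult: "x \<in> carrier G \<Longrightarrow> y \<in> carrier G \<Longrightarrow> \<pi> (x \<otimes> y) = \<pi> x \<otimes> \<pi> y"
    and K_iff: "x \<in> carrier G \<Longrightarrow> x \<in> K \<longleftrightarrow> \<pi> x = \<one>"
    and odd_K: "odd (card K)"
begin

abbreviation "GH \<equiv> G\<lparr>carrier := H\<rparr>"

lemma H_carrier: "x \<in> H \<Longrightarrow> x \<in> carrier G" using H_sub by blast
lemma K_carrier: "x \<in> K \<Longrightarrow> x \<in> carrier G" using K_sub by blast
lemma pi_carrier: "x \<in> carrier G \<Longrightarrow> \<pi> x \<in> carrier G" using H_carrier pi_in by blast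

sublocale H: char2_action GH \<rho>
proof unfold_locales
  fix x y assume "x \<in> carrier GH" "y \<in> carrier GH"
  then have "x \<in> H" "y \<in> H" by simp_all
  then have "x \<otimes> y \<in> H"
    using pi_in[of "x \<otimes> y"] pi_mult[of x y] by (simp add: H_carrier pi_id)
  then show "x \<otimes>\<^bsub>GH\<^esub> y \<in> carrier GH" by simp
qed (simp_all add: H_carrier act_add act_mult act_one double)

lemma of_nat_card_K [simp]: "of_nat (card K) = (1::'m)"
proof -
  obtain n where "card K = Suc (2 * n)"
    using odd_K by (metis oddE add.commute plus_1_eq_Suc)
  then show ?thesis
    by simp
qed

section \<open>Restriction of cochains to the subgroup\<close>

definition res :: "('g list \<Rightarrow> 'm) \<Rightarrow> 'g list \<Rightarrow> 'm" where
  "res f xs = (if set xs \<subseteq> H then f xs else 0)"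

lemma res_cochain:
  assumes f: "f \<in> cochains G \<rho>"
  shows "res f \<in> cochains GH \<rho>"
proof -
  obtain N where N: "\<forall>xs. length xs > N \<longrightarrow> f xs = 0"
    using cochains_bound[OF f] by blast
  show ?thesis
  proof (rule H.cochainsI[where N = N])
    fix g xs assume *: "g \<in> carrier GH" "set xs \<subseteq> carrier GH"
    then have "set xs \<subseteq> carrier G" "g \<in> carrier G" using H_sub by auto
    then have "f (map (\<lambda>x. g \<otimes> x) xs) = \<rho> g (f xs)"
      by (intro cochains_act[OF f])
    then show "res f (map (\<lambda>x. g \<otimes>\<^bsub>GH\<^esub> x) xs) = \<rho> g (res f xs)"
      using H.set_translate[OF *] * by (simp add: res_def)
  qed (use N cochains_Nil[OF f] in \<open>auto simp: res_def split: if_splits\<close>)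
qed

lemma coboundary_res: "coboundary GH (res f) = res (coboundary G f)"
proof
  fix xs
  have "omit_sum (res f) xs = omit_sum f xs" if "set xs \<subseteq> H"
    using that by (intro omit_sum_cong) (auto simp: res_def)
  then show "coboundary GH (res f) xs = res (coboundary G f) xs"
    using H_sub by (auto simp: H.coboundary_eq coboundary_eq res_def)
qed

lemma res_cocycle: "f \<in> carrier Z \<Longrightarrow> res f \<in> carrier H.Z"
  by (simp add: in_cocycles H.in_cocycles res_cochain coboundary_res) (simp add: res_def[abs_def])

lemma res_cup:
  assumes f: "f \<in> cochains G \<rho>" and h: "h \<in> cochains G \<rho>"
  shows "res (cup f h) = cup (res f) (res h)"
proof
  fix xs
  show "res (cup f h) xs = cup (res f) (res h) xs"
  proof (cases "set xs \<subseteq> H")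
    case True
    then have "cup (res f) (res h) xs = cup f h xs"
      by (intro cup_cong) (auto simp: res_def)
    then show ?thesis using True by (simp add: res_def)
  next
    case False
    then show ?thesis
      using H.cochains_out[OF H.cup_cochain[OF res_cochain[OF f] res_cochain[OF h]], of xs]
      by (simp add: res_def)
  qed
qed

text \<open>\<open>restriction\<close> is a union over all representatives of a class. Cohomologous
  cocycles restrict to cohomologous ones, so all members of the union coincide and one
  representative suffices.\<close>

lemma restriction_cls:
  assumes f: "f \<in> carrier Z"
  shows "restriction G \<rho> H (cls f) = H.cls (res f)"
proof -
  have "H.cls (res h) = H.cls (res f)" if h: "h \<in> cls f" for h
  proof -
    obtain b where b: "b \<in> cochains G \<rho>" "h = (\<lambda>xs. coboundary G b xs + f xs)"
      using h by (auto simp: cls_mem)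
    then have "h \<in> carrier Z"
      using add_cocycle[OF coboundary_cocycle f] by blast
    moreover have "\<forall>xs. res h xs + res f xs = coboundary GH (res b) xs"
      unfolding coboundary_res b(2) by (simp add: res_def add.assoc double)
    ultimately show ?thesis
      using H.cls_eq_iff[OF res_cocycle res_cocycle[OF f]] res_cochain[OF b(1)] by blast
  qed
  then have "(\<Union>h\<in>cls f. H.cls (res h)) = (\<Union>h\<in>cls f. H.cls (res f))"
    by (rule SUP_cong[OF refl])
  also have "\<dots> = H.cls (res f)"
    using cls_self[OF f] by (intro cSUP_const) blast
  finally show ?thesis
    by (simp add: restriction_def res_def[abs_def])
qed

section \<open>The residual action on the cohomology of the subgroup\<close>

definition twist :: "'g \<Rightarrow> ('g list \<Rightarrow> 'm) \<Rightarrow> 'g list \<Rightarrow> 'm" where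
  "twist k f xs = (if set xs \<subseteq> H then \<rho> k (f xs) else 0)"

lemma act_commute: "g \<in> carrier G \<Longrightarrow> k \<in> carrier G \<Longrightarrow> \<rho> k (\<rho> g a) = \<rho> g (\<rho> k a)"
  by (metis act_comp m_comm)

lemma twist_cochain:
  assumes k: "k \<in> carrier G" and f: "f \<in> cochains GH \<rho>"
  shows "twist k f \<in> cochains GH \<rho>"
proof -
  obtain N where N: "\<forall>xs. length xs > N \<longrightarrow> f xs = 0"
    using H.cochains_bound[OF f] by blast
  show ?thesis
  proof (rule H.cochainsI[where N = N])
    fix g xs assume *: "g \<in> carrier GH" "set xs \<subseteq> carrier GH"
    then have "f (map (\<lambda>x. g \<otimes> x) xs) = \<rho> g (f xs)"
      using H.cochains_act[OF f *] by simp
    then show "twist k f (map (\<lambda>x. g \<otimes>\<^bsub>GH\<^esub> x) xs) = \<rho> g (twist k f xs)"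
      using H.set_translate[OF *] * act_commute[of g k] k by (simp add: twist_def H_carrier)
  qed (use N H.cochains_Nil[OF f] k in \<open>auto simp: twist_def act_zero split: if_splits\<close>)
qed

lemma coboundary_twist:
  assumes k: "k \<in> carrier G"
  shows "coboundary GH (twist k f) = twist k (coboundary GH f)"
proof
  fix xs
  have "omit_sum (twist k f) xs = omit_sum (\<lambda>ys. \<rho> k (f ys)) xs" if "set xs \<subseteq> H"
    using that by (intro omit_sum_cong) (auto simp: twist_def)
  also have "omit_sum (\<lambda>ys. \<rho> k (f ys)) xs = \<rho> k (omit_sum f xs)"
    using k by (intro omit_sum_hom) (simp_all add: act_add act_zero)
  finally show "coboundary GH (twist k f) xs = twist k (coboundary GH f) xs"
    by (simp add: H.coboundary_eq twist_def)
qed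

lemma twist_cocycle: "k \<in> carrier G \<Longrightarrow> f \<in> carrier H.Z \<Longrightarrow> twist k f \<in> carrier H.Z"
  by (simp add: H.in_cocycles twist_cochain coboundary_twist) (simp add: twist_def fun_eq_iff act_zero)

text \<open>Conjugation by k is trivial in an abelian group, so the residual action only changes
  values. As for restriction, the union over representatives collapses to one class.\<close>

lemma residual_action_cls:
  assumes k: "k \<in> carrier G" and f: "f \<in> carrier H.Z"
  shows "residual_action G \<rho> H k (H.cls f) = H.cls (twist k f)"
proof -
  have "(\<lambda>xs. if set xs \<subseteq> H then \<rho> k (h (map (\<lambda>x. inv k \<otimes> x \<otimes> k) xs)) else 0) = twist k h" for h
  proof
    fix xs
    have "map (\<lambda>x. inv k \<otimes> x \<otimes> k) xs = xs" if "set xs \<subseteq> H"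
    proof (rule map_idI)
      fix x assume "x \<in> set xs"
      then have "x \<in> carrier G" using that H_carrier by blast
      then show "inv k \<otimes> x \<otimes> k = x"
        using k by (metis inv_closed inv_solve_left m_assoc m_comm m_closed)
    qed
    then show "(if set xs \<subseteq> H then \<rho> k (h (map (\<lambda>x. inv k \<otimes> x \<otimes> k) xs)) else 0) = twist k h xs"
      by (simp add: twist_def)
  qed
  then have *: "residual_action G \<rho> H k Y = (\<Union>h\<in>Y. H.cls (twist k h))" for Y
    by (simp add: residual_action_def)
  have "H.cls (twist k h) = H.cls (twist k f)" if h: "h \<in> H.cls f" for h
  proof -
    obtain b where b: "b \<in> cochains GH \<rho>" "h = (\<lambda>xs. coboundary GH b xs + f xs)"
      using h by (auto simp: H.cls_mem)
    then have "h \<in> carrier H.Z"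
      using H.add_cocycle[OF H.coboundary_cocycle f] by blast
    moreover have "\<forall>xs. twist k h xs + twist k f xs = coboundary GH (twist k b) xs"
      unfolding coboundary_twist[OF k] b(2) using k
      by (simp add: twist_def act_add add.assoc double)
    ultimately show ?thesis
      using H.cls_eq_iff[OF twist_cocycle[OF k] twist_cocycle[OF k f]] twist_cochain[OF k b(1)] by blast
  qed
  then have "(\<Union>h\<in>H.cls f. H.cls (twist k h)) = (\<Union>h\<in>H.cls f. H.cls (twist k f))"
    by (rule SUP_cong[OF refl])
  also have "\<dots> = H.cls (twist k f)"
    using H.cls_self[OF f] by (intro cSUP_const) blast
  finally show ?thesis
    by (simp add: *)
qed

text \<open>The corestriction from H to G, built from the H-equivariant map \<open>\<pi>\<close>: it
  is the sum over k in K of k f(\<open>\<pi>\<close>(k^-1 x)), where k^-1 disappears because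
  \<open>\<pi>\<close> is trivial on K.\<close>

definition transfer :: "('g list \<Rightarrow> 'm) \<Rightarrow> 'g list \<Rightarrow> 'm" where
  "transfer f xs = (if set xs \<subseteq> carrier G then \<Sum>k\<in>K. \<rho> k (f (map \<pi> xs)) else 0)"

lemma set_map_pi: "set xs \<subseteq> carrier G \<Longrightarrow> set (map \<pi> xs) \<subseteq> H"
  using pi_in by auto

text \<open>The K-component of g is c = \<open>\<pi> g\<close>^-1 g, which \<open>\<pi>\<close>
  sends to the identity. The two bijections are the reindexings of sums over K that a translation by
  g causes.\<close>

lemma K_translate:
  assumes g: "g \<in> carrier G"
  obtains c where "c \<in> K" "g = \<pi> g \<otimes> c" "bij_betw (\<lambda>k. inv c \<otimes> k) K K" "bij_betw (\<lambda>k. c \<otimes> k) K K"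
proof -
  define c where "c = inv (\<pi> g) \<otimes> g"
  have c: "c \<in> carrier G" using g by (simp add: c_def pi_carrier)
  have gc: "g = \<pi> g \<otimes> c"
    using g by (simp add: c_def pi_carrier flip: m_assoc)
  then have "\<pi> g = \<pi> g \<otimes> \<pi> c"
    using pi_mult[of "\<pi> g" c] g c by (simp add: pi_carrier pi_id pi_in)
  then have pc: "\<pi> c = \<one>"
    using g c by (simp add: pi_carrier)
  have trans: "d \<otimes> k \<in> K" if "d \<in> K" "k \<in> K" for d k
    using that K_iff[of d] K_iff[of k] K_iff[of "d \<otimes> k"] by (simp add: K_carrier pi_mult)
  have cK: "c \<in> K" using K_iff c pc by simp
  have "\<pi> \<one> = \<one>"
    using pi_mult[of \<one> \<one>] by (metis l_one one_closed pi_carrier r_cancel_one')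
  then have "\<pi> (inv c) = \<one>"
    using pi_mult[of "inv c" c] c pc by (simp add: pi_carrier)
  then have icK: "inv c \<in> K" using K_iff c by simp
  have b: "bij_betw (\<lambda>k. d \<otimes> k) K K" if "d \<in> K" "inv d \<in> K" for d
    by (rule bij_betwI[where g = "\<lambda>k. inv d \<otimes> k"])
      (use that trans in \<open>auto simp: K_carrier simp flip: m_assoc\<close>)
  show ?thesis
    using that[OF cK gc] b[of c] b[of "inv c"] cK icK c by simp
qed

text \<open>Of g = \<open>\<pi> g \<otimes> c\<close>, the H-component passes through f by
  equivariance, and the K-component c is absorbed by reindexing the sum.\<close>

lemma transfer_cochain:
  assumes f: "f \<in> cochains GH \<rho>"
  shows "transfer f \<in> cochains G \<rho>"
proof -
  obtain N where N: "\<forall>xs. length xs > N \<longrightarrow> f xs = 0"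
    using H.cochains_bound[OF f] by blast
  show ?thesis
  proof (rule cochainsI[where N = N])
    fix g xs assume *: "g \<in> carrier G" "set xs \<subseteq> carrier G"
    obtain c where c: "c \<in> K" "g = \<pi> g \<otimes> c" "bij_betw (\<lambda>k. c \<otimes> k) K K"
      using K_translate[OF *(1)] by metis
    have "map \<pi> (map (\<lambda>x. g \<otimes> x) xs) = map (\<lambda>x. \<pi> g \<otimes> x) (map \<pi> xs)"
      using * by (auto simp: pi_mult)
    then have "f (map \<pi> (map (\<lambda>x. g \<otimes> x) xs)) = \<rho> (\<pi> g) (f (map \<pi> xs))"
      using H.cochains_act[OF f, of "\<pi> g" "map \<pi> xs"] set_map_pi[OF *(2)] pi_in[OF *(1)]
      by (simp del: map_map)
    then have "transfer f (map (\<lambda>x. g \<otimes> x) xs) = (\<Sum>k\<in>K. \<rho> k (\<rho> (\<pi> g) (f (map \<pi> xs))))"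
      using set_translate[OF *] by (simp add: transfer_def del: map_map)
    also have "\<dots> = (\<Sum>k\<in>K. \<rho> (c \<otimes> k) (\<rho> (\<pi> g) (f (map \<pi> xs))))"
      using sum.reindex_bij_betw[OF c(3), of "\<lambda>k. \<rho> k (\<rho> (\<pi> g) (f (map \<pi> xs)))"] by simp
    also have "\<dots> = (\<Sum>k\<in>K. \<rho> g (\<rho> k (f (map \<pi> xs))))"
    proof (rule sum.cong)
      fix k assume k: "k \<in> K"
      have "\<rho> (c \<otimes> k) (\<rho> (\<pi> g) a) = \<rho> (\<pi> g \<otimes> c \<otimes> k) a" for a
        using k c(1) * by (simp add: act_comp K_carrier pi_carrier act_commute)
      then show "\<rho> (c \<otimes> k) (\<rho> (\<pi> g) (f (map \<pi> xs))) = \<rho> g (\<rho> k (f (map \<pi> xs)))"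
        using c(2) act_comp[OF *(1), of k] k by (simp add: K_carrier)
    qed simp
    also have "\<dots> = \<rho> g (transfer f xs)"
      using * by (simp add: transfer_def act_sum)
    finally show "transfer f (map (\<lambda>x. g \<otimes> x) xs) = \<rho> g (transfer f xs)" .
  next
    fix xs :: "'g list" assume "transfer f xs \<noteq> 0"
    then show "xs \<noteq> [] \<and> set xs \<subseteq> carrier G"
      using H.cochains_Nil[OF f] by (auto simp: transfer_def act_zero K_carrier split: if_splits)
  next
    fix xs :: "'g list" assume "length xs > N"
    then show "transfer f xs = 0"
      using N by (simp add: transfer_def act_zero K_carrier)
  qed
qed

lemma coboundary_transfer: "coboundary G (transfer f) = transfer (coboundary GH f)"
proof
  fix xs
  show "coboundary G (transfer f) xs = transfer (coboundary GH f) xs"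
  proof (cases "set xs \<subseteq> carrier G")
    case True
    then have "omit_sum (transfer f) xs = omit_sum (\<lambda>ys. \<Sum>k\<in>K. \<rho> k (f (map \<pi> ys))) xs"
      by (intro omit_sum_cong) (auto simp: transfer_def)
    also have "\<dots> = (\<Sum>k\<in>K. omit_sum (\<lambda>ys. \<rho> k (f (map \<pi> ys))) xs)"
      by (rule omit_sum_sum)
    also have "\<dots> = (\<Sum>k\<in>K. \<rho> k (omit_sum (\<lambda>ys. f (map \<pi> ys)) xs))"
      by (intro sum.cong omit_sum_hom) (simp_all add: act_add act_zero K_carrier)
    finally show ?thesis
      using True set_map_pi[OF True] by (simp add: coboundary_eq H.coboundary_eq transfer_def omit_sum_map)
  qed (simp add: coboundary_eq transfer_def)
qed

lemma transfer_cocycle: "f \<in> carrier H.Z \<Longrightarrow> transfer f \<in> carrier Z"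
  by (simp add: in_cocycles H.in_cocycles transfer_cochain coboundary_transfer)
    (simp add: transfer_def fun_eq_iff act_zero K_carrier)

text \<open>By equivariance, pulling f back along x to \<open>k \<otimes> \<pi> x\<close> amounts to
  acting by k on f composed with \<open>\<pi>\<close>. Summing the prisms of these maps over K
  therefore compares f, counted an odd number of times, with the average of its restriction.\<close>

lemma transfer_res:
  assumes f: "f \<in> carrier Z"
  shows "\<exists>q\<in>cochains G \<rho>. \<forall>xs. f xs + transfer (res f) xs = coboundary G q xs"
proof -
  have fc: "f \<in> cochains G \<rho>" using f by (rule cocycles_cochain)
  obtain q where q: "q \<in> cochains G \<rho>" "\<And>xs. set xs \<subseteq> carrier G \<Longrightarrow>
    coboundary G q xs = (\<Sum>k\<in>K. f xs + f (map (\<lambda>x. k \<otimes> \<pi> x) xs))"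
  proof -
    have "\<exists>q\<in>cochains G \<rho>. \<forall>xs. set xs \<subseteq> carrier G \<longrightarrow>
      coboundary G q xs = (\<Sum>k\<in>K. f xs + f (map (\<lambda>x. k \<otimes> \<pi> x) xs))"
    proof (rule prism_homotopy[OF f])
      fix g assume g: "g \<in> carrier G"
      obtain c where c: "c \<in> K" "g = \<pi> g \<otimes> c" "bij_betw (\<lambda>k. inv c \<otimes> k) K K"
        using K_translate[OF g] by metis
      \<comment> \<open>The permutation of K is k to c^-1 k: the projection forgets the factor c of
        g, so writing g in front introduces c, which c^-1 must undo.\<close>
      have "k \<otimes> \<pi> (g \<otimes> x) = g \<otimes> (inv c \<otimes> k \<otimes> \<pi> x)" if k: "k \<in> K" and x: "x \<in> carrier G" for k x
      proof -
        have cr: "k \<in> carrier G" "c \<in> carrier G" "\<pi> g \<in> carrier G" "\<pi> x \<in> carrier G"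
          using k x g c by (auto simp: K_carrier pi_carrier)
        have "c \<otimes> (inv c \<otimes> (k \<otimes> \<pi> x)) = k \<otimes> \<pi> x"
          using cr by (simp flip: m_assoc)
        then have "g \<otimes> (inv c \<otimes> k \<otimes> \<pi> x) = \<pi> g \<otimes> (c \<otimes> inv c) \<otimes> k \<otimes> \<pi> x"
          using cr by (subst c(2)) (simp add: m_assoc)
        also have "\<dots> = k \<otimes> (\<pi> g \<otimes> \<pi> x)"
          using cr by (simp add: m_ac)
        finally show ?thesis using g x by (simp add: pi_mult)
      qed
      then show "\<exists>\<sigma>. bij_betw \<sigma> K K \<and>
          (\<forall>k\<in>K. \<forall>x\<in>carrier G. k \<otimes> \<pi> (g \<otimes> x) = g \<otimes> (\<sigma> k \<otimes> \<pi> x))"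
        using c(3) by blast
    qed (simp add: K_carrier pi_carrier)
    then show ?thesis using that by blast
  qed
  have "f xs + transfer (res f) xs = coboundary G q xs" for xs
  proof (cases "set xs \<subseteq> carrier G")
    case True
    note xs = set_map_pi[OF True]
    have "f (map (\<lambda>x. k \<otimes> \<pi> x) xs) = \<rho> k (f (map \<pi> xs))" if "k \<in> K" for k
      using cochains_act[OF fc K_carrier[OF that], of "map \<pi> xs"] xs H_sub
      by (simp add: comp_def subset_trans[OF _ H_sub])
    then show ?thesis
      using q(2)[OF True] True xs by (simp add: sum.distrib transfer_def res_def)
  next
    case False
    then show ?thesis using cochains_out[OF fc False] by (simp add: coboundary_eq transfer_def)
  qed
  then show ?thesis using q(1) by blast
qed

text \<open>A group acts trivially on its own cohomology. Translation by k commutes with all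
  translations of an abelian group, so its prism alone is a homotopy, and pulling a cochain back
  along it is acting by k.\<close>

lemma twist_res:
  assumes f: "f \<in> carrier Z" and k: "k \<in> carrier G"
  shows "H.cls (twist k (res f)) = H.cls (res f)"
proof -
  have fc: "f \<in> cochains G \<rho>" using f by (rule cocycles_cochain)
  have "\<exists>q\<in>cochains G \<rho>. \<forall>xs. set xs \<subseteq> carrier G \<longrightarrow>
      coboundary G q xs = (\<Sum>l\<in>{k}. f xs + f (map (\<lambda>x. l \<otimes> x) xs))"
  proof (rule prism_homotopy[OF f])
    fix g assume "g \<in> carrier G"
    then have "\<forall>l\<in>{k}. \<forall>x\<in>carrier G. l \<otimes> (g \<otimes> x) = g \<otimes> (id l \<otimes> x)"
      using k m_lcomm by auto
    then show "\<exists>\<sigma>. bij_betw \<sigma> {k} {k} \<and> (\<forall>l\<in>{k}. \<forall>x\<in>carrier G. l \<otimes> (g \<otimes> x) = g \<otimes> (\<sigma> l \<otimes> x))"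
      using bij_betw_id by blast
  qed (use k in auto)
  then obtain q where q: "q \<in> cochains G \<rho>" "\<And>xs. set xs \<subseteq> carrier G \<Longrightarrow>
      coboundary G q xs = f xs + \<rho> k (f xs)"
    using cochains_act[OF fc k] by auto
  have "twist k (res f) xs + res f xs = coboundary GH (res q) xs" for xs
    using q(2)[OF subset_trans[OF _ H_sub], of xs]
    by (simp add: coboundary_res twist_def res_def add.commute)
  then show ?thesis
    using H.cls_eq_iff[OF twist_cocycle[OF k res_cocycle[OF f]] res_cocycle[OF f]]
      res_cochain[OF q(1)] by blast
qed

text \<open>On H the projection is the identity, so the restricted average is the sum of the twists
  of f over K. Each twist is cohomologous to f, and their number is odd.\<close>

lemma res_transfer:
  assumes f: "f \<in> carrier H.Z" and inv: "\<And>k. k \<in> K \<Longrightarrow> H.cls (twist k f) = H.cls f"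
  shows "H.cls (res (transfer f)) = H.cls f"
proof -
  have "\<forall>k\<in>K. \<exists>q. q \<in> cochains GH \<rho> \<and> (\<forall>xs. twist k f xs + f xs = coboundary GH q xs)"
    using inv H.cls_eq_iff[OF twist_cocycle[OF K_carrier f] f] by blast
  then obtain q where q: "\<And>k. k \<in> K \<Longrightarrow> q k \<in> cochains GH \<rho>"
    "\<And>k xs. k \<in> K \<Longrightarrow> twist k f xs + f xs = coboundary GH (q k) xs"
    unfolding bchoice_iff by blast
  have "res (transfer f) xs + f xs = coboundary GH (\<lambda>xs. \<Sum>k\<in>K. q k xs) xs" for xs
  proof -
    have "res (transfer f) xs = (\<Sum>k\<in>K. twist k f xs)"
    proof (cases "set xs \<subseteq> H")
      case True
      then have "map \<pi> xs = xs" using pi_id by (intro map_idI) blast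
      then show ?thesis using True H_sub by (auto simp: res_def transfer_def twist_def)
    qed (simp add: res_def twist_def)
    then have "res (transfer f) xs + f xs = (\<Sum>k\<in>K. twist k f xs + f xs)"
      by (simp add: sum.distrib)
    also have "\<dots> = coboundary GH (\<lambda>xs. \<Sum>k\<in>K. q k xs) xs"
      by (simp add: H.coboundary_sum q(2))
    finally show ?thesis .
  qed
  then show ?thesis
    using H.cls_eq_iff[OF res_cocycle[OF transfer_cocycle[OF f]] f] H.sum_cochain[of K q] q(1) by blast
qed

text \<open>Restriction respects the ring operations already on cochains; \<open>transfer\<close>,
  used only as a map on cochains, supplies injectivity and surjectivity onto the invariants.\<close>

theorem restriction_ring_iso:
  "restriction G \<rho> H \<in> ring_iso (cohomology_ring G \<rho>)
     ((cohomology_ring GH \<rho>)\<lparr>carrier := residual_invariants G \<rho> H K\<rparr>)"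
proof (rule ring_iso_memI)
  let ?r = "restriction G \<rho> H" and ?R = "cohomology_ring G \<rho>" and ?S = "cohomology_ring GH \<rho>"
  have in_inv: "?r (cls f) \<in> residual_invariants G \<rho> H K" if "f \<in> carrier Z" for f
    using that
    by (auto simp: residual_invariants_def restriction_cls H.carrier_cohomology res_cocycle
        residual_action_cls K_carrier twist_res)
  show "?r U \<in> carrier (?S\<lparr>carrier := residual_invariants G \<rho> H K\<rparr>)" if "U \<in> carrier ?R" for U
    using that in_inv by (auto simp: carrier_cohomology)
  show "?r (U \<otimes>\<^bsub>?R\<^esub> V) = ?r U \<otimes>\<^bsub>?S\<lparr>carrier := residual_invariants G \<rho> H K\<rparr>\<^esub> ?r V"
    if UV: "U \<in> carrier ?R" "V \<in> carrier ?R" for U V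
  proof -
    obtain f h where fh: "f \<in> carrier Z" "h \<in> carrier Z" "U = cls f" "V = cls h"
      using UV by (auto simp: carrier_cohomology)
    then have "U \<otimes>\<^bsub>?R\<^esub> V = cls (cup f h)"
      using ring_hom_mult[OF cls_hom, of f h] by simp
    moreover have "?r U \<otimes>\<^bsub>?S\<^esub> ?r V = H.cls (cup (res f) (res h))"
      using ring_hom_mult[OF H.cls_hom res_cocycle[OF fh(1)] res_cocycle[OF fh(2)]] fh
      by (simp add: restriction_cls)
    ultimately show ?thesis
      using fh by (simp add: restriction_cls cup_cocycle res_cup cocycles_cochain)
  qed
  show "?r (U \<oplus>\<^bsub>?R\<^esub> V) = ?r U \<oplus>\<^bsub>?S\<lparr>carrier := residual_invariants G \<rho> H K\<rparr>\<^esub> ?r V"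
    if UV: "U \<in> carrier ?R" "V \<in> carrier ?R" for U V
  proof -
    obtain f h where fh: "f \<in> carrier Z" "h \<in> carrier Z" "U = cls f" "V = cls h"
      using UV by (auto simp: carrier_cohomology)
    then have "U \<oplus>\<^bsub>?R\<^esub> V = cls (\<lambda>xs. f xs + h xs)"
      using ring_hom_add[OF cls_hom, of f h] by simp
    moreover have "?r U \<oplus>\<^bsub>?S\<^esub> ?r V = H.cls (\<lambda>xs. res f xs + res h xs)"
      using ring_hom_add[OF H.cls_hom res_cocycle[OF fh(1)] res_cocycle[OF fh(2)]] fh
      by (simp add: restriction_cls)
    moreover have "res (\<lambda>xs. f xs + h xs) = (\<lambda>xs. res f xs + res h xs)"
      by (auto simp: res_def)
    ultimately show ?thesis
      using fh by (simp add: restriction_cls add_cocycle)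
  qed
  show "?r \<one>\<^bsub>?R\<^esub> = \<one>\<^bsub>?S\<lparr>carrier := residual_invariants G \<rho> H K\<rparr>\<^esub>"
  proof -
    have "res (const_cochain G 1) = const_cochain GH 1"
      using H_sub by (auto simp: fun_eq_iff res_def const_cochain_def)
    moreover have "const_cochain G 1 \<in> carrier Z"
      by (simp add: const_cocycle act_one)
    ultimately show ?thesis
      using ring_hom_one[OF cls_hom] ring_hom_one[OF H.cls_hom]
      by (simp flip: restriction_cls) (metis restriction_cls)
  qed
  have "inj_on ?r (carrier ?R)"
  proof (rule inj_onI)
    fix U V assume UV: "U \<in> carrier ?R" "V \<in> carrier ?R" "?r U = ?r V"
    obtain f h where fh: "f \<in> carrier Z" "h \<in> carrier Z" "U = cls f" "V = cls h"
      using UV by (auto simp: carrier_cohomology)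
    define d where "d = (\<lambda>xs. f xs + h xs)"
    have d: "d \<in> carrier Z" using fh by (simp add: d_def add_cocycle)
    obtain b where b: "b \<in> cochains GH \<rho>" "\<forall>xs. res f xs + res h xs = coboundary GH b xs"
      using UV(3) fh H.cls_eq_iff[OF res_cocycle res_cocycle] by (auto simp: restriction_cls)
    obtain q where q: "q \<in> cochains G \<rho>" "\<forall>xs. d xs + transfer (res d) xs = coboundary G q xs"
      using transfer_res[OF d] by blast
    have "res d = coboundary GH b"
      using b(2) by (auto simp: d_def res_def fun_eq_iff split: if_splits)
    \<comment> \<open>The averaged restriction of d is a coboundary; added to the homotopy q, this
      exhibits d itself as one.\<close>
    then have "transfer (res d) = coboundary G (transfer b)"
      by (simp add: coboundary_transfer)
    then have "f xs + h xs = coboundary G (\<lambda>xs. q xs + transfer b xs) xs" for xs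
      using q(2) by (simp add: coboundary_add d_def) (metis add.assoc add.commute double')
    then show "U = V"
      using cls_eq_iff[OF fh(1,2)] add_cochain[OF q(1) transfer_cochain[OF b(1)]] fh(3,4) by blast
  qed
  moreover have "?r ` carrier ?R = residual_invariants G \<rho> H K"
  proof
    show "?r ` carrier ?R \<subseteq> residual_invariants G \<rho> H K"
      using in_inv by (auto simp: carrier_cohomology)
    show "residual_invariants G \<rho> H K \<subseteq> ?r ` carrier ?R"
    proof
      fix V assume V: "V \<in> residual_invariants G \<rho> H K"
      then obtain f where f: "f \<in> carrier H.Z" "V = H.cls f"
        by (auto simp: residual_invariants_def H.carrier_cohomology)
      have "H.cls (twist k f) = H.cls f" if "k \<in> K" for k
        using V f that by (simp add: residual_invariants_def residual_action_cls K_carrier)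
      then have "?r (cls (transfer f)) = V"
        using f by (simp add: res_transfer restriction_cls transfer_cocycle)
      then show "V \<in> ?r ` carrier ?R"
        using transfer_cocycle[OF f(1)] by (auto simp: carrier_cohomology)
    qed
  qed
  ultimately show "bij_betw ?r (carrier ?R) (carrier (?S\<lparr>carrier := residual_invariants G \<rho> H K\<rparr>))"
    by (simp add: bij_betw_def)
qed

end

section \<open>The cyclic group of order two acting trivially\<close>

text \<open>The unit v stands for u^-1, the value on unequal pairs of the cocycle that represents
  alpha.\<close>

locale trivial_C2 = char2_action G \<rho>
  for G :: "('g, 'b) monoid_scheme" (structure) and \<rho> :: "'g \<Rightarrow> 'm \<Rightarrow> 'm::comm_ring_1" +
  fixes e s :: 'g and v v' :: 'm
  assumes carrier_eq: "carrier G = {e, s}" and e_neq_s: "e \<noteq> s"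
    and table: "e \<otimes> e = e" "e \<otimes> s = s" "s \<otimes> e = s" "s \<otimes> s = e"
    and trivial_act: "g \<in> carrier G \<Longrightarrow> \<rho> g a = a"
    and v_inverse: "v * v' = 1"
begin

section \<open>Alternating lists and the cocycles supported on them\<close>

fun alternating :: "'g list \<Rightarrow> bool" where
  "alternating [] = False"
| "alternating [x] = (x \<in> {e, s})"
| "alternating (x # y # xs) = (x \<in> {e, s} \<and> x \<noteq> y \<and> alternating (y # xs))"

lemma alternating_carrier: "alternating xs \<Longrightarrow> xs \<noteq> [] \<and> set xs \<subseteq> carrier G"
  by (induction xs rule: alternating.induct) (auto simp: carrier_eq)

text \<open>The pieces share the entry at position p, so every pair of neighbours of the list
  survives in one of them.\<close>

lemma alternating_split:
  "p < length xs \<Longrightarrow> alternating (take (Suc p) xs) \<and> alternating (drop p xs) \<longleftrightarrow> alternating xs"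
proof (induction xs arbitrary: p rule: alternating.induct)
  case (3 x y xs)
  show ?case
  proof (cases p)
    case 0
    then show ?thesis by auto
  next
    case (Suc q)
    then show ?thesis using 3 by auto
  qed
qed auto

lemma alternating_translate:
  assumes "g \<in> carrier G" "set xs \<subseteq> carrier G"
  shows "alternating (map (\<lambda>x. g \<otimes> x) xs) = alternating xs"
  using assms(2)
proof (induction xs rule: alternating.induct)
  case (2 x)
  then show ?case using assms(1) by (auto simp: carrier_eq table)
next
  case (3 x y xs)
  have "g \<otimes> x \<noteq> g \<otimes> y \<longleftrightarrow> x \<noteq> y" "g \<otimes> x \<in> {e, s}" "x \<in> {e, s}"
    using assms(1) 3 e_neq_s by (auto simp: carrier_eq table)
  then show ?case using 3 by simp
qed simp

text \<open>Alternating lists are the nondegenerate simplices for a group of order two. There are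
  two in each degree, exchanged by translation, so an invariant normalised cochain is one value per
  degree. The power of v makes the variable of the polynomial correspond to the degree-one class
  with value v.\<close>

definition cocycle_of :: "'m poly \<Rightarrow> 'g list \<Rightarrow> 'm" where
  "cocycle_of p xs =
     (if alternating xs then Polynomial.coeff p (length xs - 1) * v ^ (length xs - 1) else 0)"

lemma cocycle_of_add: "cocycle_of (p + q) = (\<lambda>xs. cocycle_of p xs + cocycle_of q xs)"
  by (auto simp: cocycle_of_def fun_eq_iff algebra_simps)

lemma cocycle_of_0: "cocycle_of 0 = (\<lambda>_. 0)"
  by (auto simp: cocycle_of_def)

lemma cocycle_of_const: "cocycle_of [:a:] = const_cochain G a"
proof
  fix xs :: "'g list"
  consider "xs = []" | x where "xs = [x]" | x y ys where "xs = x # y # ys"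
    by (cases xs rule: remdups_adj.cases) auto
  then show "cocycle_of [:a:] xs = const_cochain G a xs"
    by cases (auto simp: cocycle_of_def const_cochain_def carrier_eq)
qed

text \<open>Every cut of an alternating list of length n + 1 has alternating pieces, so all
  splittings of the degree n contribute, which is polynomial multiplication. The identity holds for
  cochains, before passing to classes.\<close>

lemma cocycle_of_mult: "cocycle_of (p * q) = cup (cocycle_of p) (cocycle_of q)"
proof
  fix xs
  show "cocycle_of (p * q) xs = cup (cocycle_of p) (cocycle_of q) xs"
  proof (cases "alternating xs")
    case True
    then obtain n where n: "length xs = Suc n"
      using alternating_carrier by (metis length_0_conv not0_implies_Suc)
    have "cup (cocycle_of p) (cocycle_of q) xs =
        (\<Sum>k\<le>n. (Polynomial.coeff p k * Polynomial.coeff q (n - k)) * v ^ n)"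
      unfolding cup_def n lessThan_Suc_atMost
    proof (rule sum.cong)
      fix k assume "k \<in> {..n}"
      then have k: "k \<le> n" by simp
      have "alternating (take (Suc k) xs)" "alternating (drop k xs)"
        using alternating_split[of k xs] True n k by auto
      moreover have "v ^ n = v ^ k * v ^ (n - k)"
        using k by (simp flip: power_add)
      ultimately show "cocycle_of p (take (Suc k) xs) * cocycle_of q (drop k xs) =
          Polynomial.coeff p k * Polynomial.coeff q (n - k) * v ^ n"
        using n k by (simp add: cocycle_of_def min_def algebra_simps Suc_diff_le)
    qed simp
    then show ?thesis
      using True n by (simp add: cocycle_of_def coeff_mult sum_distrib_right)
  next
    case False
    have "cocycle_of p (take (Suc k) xs) * cocycle_of q (drop k xs) = 0" if "k < length xs" for k
      using alternating_split[OF that] False by (auto simp: cocycle_of_def)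
    then show ?thesis using False by (simp add: cocycle_of_def cup_def)
  qed
qed

lemma cocycle_of_cochain: "cocycle_of p \<in> cochains G \<rho>"
proof (rule cochainsI[where N = "Suc (Polynomial.degree p)"])
  fix xs :: "'g list" assume "cocycle_of p xs \<noteq> 0"
  then show "xs \<noteq> [] \<and> set xs \<subseteq> carrier G"
    using alternating_carrier by (simp add: cocycle_of_def split: if_splits)
next
  fix xs :: "'g list" assume "length xs > Suc (Polynomial.degree p)"
  then show "cocycle_of p xs = 0"
    by (simp add: cocycle_of_def coeff_eq_0)
qed (simp add: cocycle_of_def alternating_translate trivial_act)

text \<open>Only lists of length 3 have faces of length 2, and among three elements of a two-element
  set the number of unequal pairs is 0 or 2.\<close>

lemma cocycle_of_linear_cocycle: "cocycle_of [:0, a:] \<in> carrier Z"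
proof -
  have "omit_sum (cocycle_of [:0, a:]) xs = 0" if xs: "set xs \<subseteq> {e, s}" for xs
  proof (cases "length xs = 3")
    case True
    then obtain x y z where "xs = [x, y, z]"
      by (auto simp: length_Suc_conv numeral_3_eq_3)
    moreover from this have "x \<in> {e, s}" "y \<in> {e, s}" "z \<in> {e, s}" using xs by auto
    ultimately show ?thesis
      using e_neq_s by (auto simp: cocycle_of_def double)
  next
    case False
    have "cocycle_of [:0, a:] ys = 0" if len: "length ys \<noteq> 2" for ys
    proof -
      consider "ys = []" | x where "ys = [x]" | x y zs where "ys = x # y # zs" "zs \<noteq> []"
        by (rule remdups_adj.cases[of ys]) (use len in auto)
      then show ?thesis by cases (auto simp: cocycle_of_def neq_Nil_conv)
    qed
    then have "omit_sum (cocycle_of [:0, a:]) xs = omit_sum (\<lambda>_. 0) xs"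
      using False by (intro omit_sum_cong) auto
    then show ?thesis by simp
  qed
  then show ?thesis
    by (simp add: in_cocycles cocycle_of_cochain coboundary_eq fun_eq_iff carrier_eq)
qed

text \<open>Constants and the variable generate all polynomials, and cocycles are closed under sums
  and cup products.\<close>

lemma cocycle_of_cocycle: "cocycle_of p \<in> carrier Z"
proof (induction p)
  case 0
  show ?case using cocycle_of_linear_cocycle[of 0] by simp
next
  case (pCons a p)
  have "pCons a p = [:a:] + [:0, 1:] * p" by simp
  then have "cocycle_of (pCons a p) =
      (\<lambda>xs. const_cochain G a xs + cup (cocycle_of [:0, 1:]) (cocycle_of p) xs)"
    by (metis cocycle_of_add cocycle_of_mult cocycle_of_const)
  then show ?case
    by (simp only: add_cocycle cup_cocycle const_cocycle trivial_act cocycle_of_linear_cocycle pCons.IH)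
qed

lemma cochain_singleton: "f \<in> cochains G \<rho> \<Longrightarrow> f [s] = f [e]"
  using cochains_act[of f s "[e]"] by (simp add: carrier_eq table trivial_act)

text \<open>The transfer from the trivial group, composed with the contraction of its cochain complex.\<close>

definition contract :: "('g list \<Rightarrow> 'm) \<Rightarrow> 'g list \<Rightarrow> 'm" where
  "contract f xs = (if xs = [] \<or> \<not> set xs \<subseteq> carrier G then 0 else f (e # xs) + f (s # xs))"

lemma contract_cochain:
  assumes f: "f \<in> cochains G \<rho>"
  shows "contract f \<in> cochains G \<rho>"
proof -
  obtain N where N: "\<forall>xs. length xs > N \<longrightarrow> f xs = 0"
    using cochains_bound[OF f] by blast
  show ?thesis
  proof (rule cochainsI[where N = N])
    fix g xs assume *: "g \<in> carrier G" "set xs \<subseteq> carrier G"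
    have "f (map (\<lambda>x. g \<otimes> x) (h # xs)) = f (h # xs)" if "h \<in> carrier G" for h
      using cochains_act[OF f *(1), of "h # xs"] that * by (simp add: trivial_act)
    from this[of e] this[of s] have "f (g \<otimes> e # map (\<lambda>x. g \<otimes> x) xs) = f (e # xs)"
      "f (g \<otimes> s # map (\<lambda>x. g \<otimes> x) xs) = f (s # xs)"
      by (simp_all add: carrier_eq)
    then have "f (e # map (\<lambda>x. g \<otimes> x) xs) + f (s # map (\<lambda>x. g \<otimes> x) xs) = f (e # xs) + f (s # xs)"
      using *(1) by (auto simp: carrier_eq table add.commute)
    then show "contract f (map (\<lambda>x. g \<otimes> x) xs) = \<rho> g (contract f xs)"
      using * set_translate[OF *] by (simp add: contract_def trivial_act)
  qed (use N in \<open>auto simp: contract_def split: if_splits\<close>)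
qed

text \<open>Omitting the newly prepended entry gives the same list for e and for s, so these two
  terms cancel and only the faces of the original list remain.\<close>

lemma coboundary_contract:
  assumes f: "f \<in> cochains G \<rho>"
  shows "coboundary G (contract f) = contract (coboundary G f)"
proof
  fix xs
  show "coboundary G (contract f) xs = contract (coboundary G f) xs"
  proof (cases "set xs \<subseteq> carrier G \<and> xs \<noteq> []")
    case True
    then have es: "set (e # xs) \<subseteq> carrier G" "set (s # xs) \<subseteq> carrier G"
      by (auto simp: carrier_eq)
    have "omit_sum (contract f) xs = omit_sum (\<lambda>ys. f (e # ys) + f (s # ys)) xs"
    proof (cases "length xs = 1")
      case True
      \<comment> \<open>The only face here is the empty list, where \<open>contract f\<close> is 0
        by definition; it matches f [e] + f [s], which is 0 by invariance.\<close>
      then obtain x where "xs = [x]" by (auto simp: length_Suc_conv)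
      then show ?thesis using cochain_singleton[OF f] by (simp add: contract_def double)
    next
      case False
      then show ?thesis using True
        by (intro omit_sum_cong) (auto simp: contract_def)
    qed
    then show ?thesis
      using True es by (simp add: coboundary_eq contract_def omit_sum_add
          add.assoc add.commute add.left_commute double)
  next
    case False
    then show ?thesis by (auto simp: coboundary_eq contract_def)
  qed
qed

text \<open>Exactly one of e and s differs from the head of an alternating list, so exactly one of
  the two extensions is alternating. One power of v is left over from the degree that was
  lost.\<close>

lemma contract_cocycle_of: "contract (cocycle_of (pCons a p)) = cocycle_of (Polynomial.smult v p)"
proof
  fix xs
  show "contract (cocycle_of (pCons a p)) xs = cocycle_of (Polynomial.smult v p) xs"
  proof (cases xs)
    case (Cons x ys)
    show ?thesis
    proof (cases "set xs \<subseteq> carrier G")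
      case True
      then have "x = e \<or> x = s" using Cons by (simp add: carrier_eq)
      then show ?thesis
        using True e_neq_s Cons by (auto simp: contract_def cocycle_of_def algebra_simps)
    next
      case False
      then show ?thesis
        using alternating_carrier[of xs] by (auto simp: contract_def cocycle_of_def)
    qed
  qed (simp add: contract_def cocycle_of_def)
qed

lemma coboundary_singleton: "g \<in> cochains G \<rho> \<Longrightarrow> coboundary G g [x] = 0"
  using cochains_Nil by (simp add: coboundary_eq)

text \<open>Coboundaries vanish on lists of length 1, so the constant coefficient is 0. Contraction
  keeps the equation and brings the next coefficient into degree 0, multiplied by a unit.\<close>

lemma cocycle_of_eq_coboundary:
  assumes "g \<in> cochains G \<rho>" "cocycle_of p = coboundary G g"
  shows "p = 0"
proof -
  have "Polynomial.coeff p n = 0" for n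
    using assms
  proof (induction n arbitrary: p g)
    case 0
    have "Polynomial.coeff p 0 = cocycle_of p [e]" by (simp add: cocycle_of_def)
    then show ?case using 0 coboundary_singleton by simp
  next
    case (Suc n)
    obtain a q where p: "p = pCons a q" by (cases p)
    have "cocycle_of (Polynomial.smult v q) = coboundary G (contract g)"
      using Suc.prems p by (metis coboundary_contract contract_cocycle_of)
    then have "v * Polynomial.coeff q n = 0"
      using Suc.IH[OF contract_cochain[OF Suc.prems(1)]] by (metis coeff_smult)
    then have "(v * v') * Polynomial.coeff q n = 0"
      by (metis mult.assoc mult.commute mult_zero_left)
    then show ?case by (simp add: v_inverse p)
  qed
  then show ?thesis by (simp add: poly_eq_iff)
qed

text \<open>Division with remainder by the degree-one class: \<open>v'\<close> normalises its
  cocycle to the value 1 on unequal pairs, and \<open>contract f\<close> is the quotient. At a list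
  x, y, ... with x and y distinct, the cup product gives f(x, y, ...) + f(y, y, ...); the coboundary
  of g is f(y, y, ...) and corrects this, and it also provides the whole value when x = y.\<close>

lemma cocycle_decomposition:
  assumes f: "f \<in> carrier Z"
  shows "\<exists>g\<in>cochains G \<rho>. \<forall>xs. f xs =
    const_cochain G (f [e]) xs + cup (cocycle_of [:0, v':]) (contract f) xs + coboundary G g xs"
proof -
  define g where "g xs = (if xs = [] then 0 else f (hd xs # xs))" for xs
  have fc: "f \<in> cochains G \<rho>" and df: "coboundary G f = (\<lambda>_. 0)"
    using f by (simp_all add: in_cocycles)
  obtain N where N: "\<forall>xs. length xs > N \<longrightarrow> f xs = 0"
    using cochains_bound[OF fc] by blast
  have "g \<in> cochains G \<rho>"
  proof (rule cochainsI[where N = N])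
    fix h and xs :: "'g list" assume *: "h \<in> carrier G" "set xs \<subseteq> carrier G" "xs \<noteq> []"
    then have "set (hd xs # xs) \<subseteq> carrier G" by (cases xs) auto
    from cochains_act[OF fc *(1) this] show "g (map (\<lambda>x. h \<otimes> x) xs) = \<rho> h (g xs)"
      using *(3) by (simp add: g_def hd_map)
  next
    fix xs :: "'g list" assume "g xs \<noteq> 0"
    then show "xs \<noteq> [] \<and> set xs \<subseteq> carrier G"
      using cochains_out[OF fc, of "hd xs # xs"] by (auto simp: g_def split: if_splits)
  qed (use N in \<open>simp add: g_def\<close>)
  moreover have "f xs =
    const_cochain G (f [e]) xs + cup (cocycle_of [:0, v':]) (contract f) xs + coboundary G g xs" for xs
  proof (cases "set xs \<subseteq> carrier G")
    case False
    moreover have "cup (cocycle_of [:0, v':]) (contract f) \<in> cochains G \<rho>"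
      by (intro cup_cochain contract_cochain fc cocycle_of_cochain)
    ultimately show ?thesis
      using cochains_out[OF fc False] cochains_out[of "cup (cocycle_of [:0, v':]) (contract f)" xs]
      by (simp add: const_cochain_def coboundary_eq)
  next
    case True
    consider "xs = []" | x where "xs = [x]" | x y zs where "xs = x # y # zs"
      by (cases xs rule: remdups_adj.cases) auto
    then show ?thesis
    proof cases
      case 1
      then show ?thesis using cochains_Nil[OF fc] by (simp add: const_cochain_def coboundary_eq)
    next
      case 2
      then have "f [x] = f [e]" using True cochain_singleton[OF fc] by (auto simp: carrier_eq)
      then show ?thesis
        using 2 True by (simp add: const_cochain_def coboundary_eq g_def cocycle_of_def)
    next
      case 3
      have xy: "x \<in> {e, s}" "y \<in> {e, s}" using True 3 by (simp_all add: carrier_eq)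
      have "cup (\<lambda>ys. cocycle_of [:0, v':] (x # y # ys)) (contract f) zs = 0"
      proof (rule cup_eq_0I)
        fix ys assume "cocycle_of [:0, v':] (x # y # ys) \<noteq> 0" "ys \<noteq> []"
        then show False
          by (cases ys) (auto simp: cocycle_of_def split: if_splits)
      qed
      then have cup: "cup (cocycle_of [:0, v':]) (contract f) xs =
          (if x = y then 0 else f (e # y # zs) + f (s # y # zs))"
        using xy True 3 v_inverse
        by (auto simp: cocycle_of_def contract_def mult.commute)
      \<comment> \<open>The cocycle condition at the list with its first entry doubled: omitting
        either copy gives f(xs), these cancel, and the remaining faces sum to 0.\<close>
      have "coboundary G f (x # xs) = 0" using df by simp
      then have "omit_sum (\<lambda>ys. f (x # x # ys)) (y # zs) = 0"
        using True 3 by (simp add: coboundary_eq)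
      moreover have "omit_sum (\<lambda>ys. g (x # ys)) (y # zs) = omit_sum (\<lambda>ys. f (x # x # ys)) (y # zs)"
        by (intro omit_sum_cong) (simp add: g_def)
      ultimately have "coboundary G g xs = f (y # y # zs)"
        using True 3 by (simp add: coboundary_eq g_def)
      then show ?thesis
        using cup xy e_neq_s 3 by (auto simp: const_cochain_def add.assoc add.commute double)
    qed
  qed
  ultimately show ?thesis by blast
qed

text \<open>Induction on a bound for the length: \<open>contract f\<close> is a cocycle with a
  smaller bound. If it is a polynomial up to a coboundary, then so is its product with the
  degree-one cocycle, and the decomposition recovers f.\<close>

lemma cocycle_cohomologous_cocycle_of:
  assumes "f \<in> carrier Z"
  shows "\<exists>p. \<exists>k\<in>cochains G \<rho>. \<forall>xs. f xs = cocycle_of p xs + coboundary G k xs"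
proof -
  obtain N where "\<forall>xs. length xs > N \<longrightarrow> f xs = 0"
    using cochains_bound[OF cocycles_cochain[OF assms]] by blast
  then show ?thesis using assms
  proof (induction N arbitrary: f)
    case 0
    then have "f xs = 0" for xs
      using cochains_Nil[OF cocycles_cochain[OF 0(2)]] by (cases xs) auto
    then show ?case
      using zero_cochain by (intro exI[of _ 0] bexI[of _ "\<lambda>_. 0"]) (simp_all add: cocycle_of_0 coboundary_eq)
  next
    case (Suc N)
    let ?x = "cocycle_of [:0, v':]"
    have fc: "f \<in> cochains G \<rho>" and df: "coboundary G f = (\<lambda>_. 0)"
      using Suc.prems(2) by (simp_all add: in_cocycles)
    have "contract (\<lambda>_. 0) = (\<lambda>_. 0)" by (auto simp: contract_def)
    then have "contract f \<in> carrier Z"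
      using df fc by (simp add: in_cocycles contract_cochain coboundary_contract)
    moreover have "\<forall>xs. length xs > N \<longrightarrow> contract f xs = 0"
      using Suc.prems(1) by (simp add: contract_def)
    ultimately obtain q k where qk: "k \<in> cochains G \<rho>"
      "\<forall>xs. contract f xs = cocycle_of q xs + coboundary G k xs"
      using Suc.IH by blast
    obtain g where g: "g \<in> cochains G \<rho>" "\<forall>xs. f xs =
        const_cochain G (f [e]) xs + cup ?x (contract f) xs + coboundary G g xs"
      using cocycle_decomposition[OF Suc.prems(2)] by blast
    have xc: "?x \<in> cochains G \<rho>" and dx: "coboundary G ?x = (\<lambda>_. 0)"
      using cocycle_of_linear_cocycle by (simp_all add: in_cocycles)
    have "contract f = (\<lambda>xs. cocycle_of q xs + coboundary G k xs)"
      using qk(2) by auto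
    then have "cup ?x (contract f) xs = cup ?x (cocycle_of q) xs + coboundary G (cup ?x k) xs" for xs
      by (simp add: cup_add_right coboundary_cup[OF xc qk(1)] dx)
    then have "f xs = cocycle_of ([:f [e]:] + [:0, v':] * q) xs + coboundary G (\<lambda>xs. cup ?x k xs + g xs) xs" for xs
      using g(2)[rule_format, of xs] unfolding cocycle_of_add cocycle_of_mult coboundary_add cocycle_of_const
      by (simp add: add.assoc)
    moreover have "(\<lambda>xs. cup ?x k xs + g xs) \<in> cochains G \<rho>"
      by (intro add_cochain cup_cochain xc qk(1) g(1))
    ultimately show ?case by blast
  qed
qed

theorem cocycle_of_ring_iso:
  "(\<lambda>p. cls (cocycle_of p)) \<in> ring_iso (ring_of_type_algebra :: 'm poly ring) (cohomology_ring G \<rho>)"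
proof (rule ring_iso_memI)
  let ?R = "ring_of_type_algebra :: 'm poly ring"
  note type_ring = ring_of_type_algebra_def
  fix p q :: "'m poly"
  show "cls (cocycle_of p) \<in> carrier (cohomology_ring G \<rho>)"
    by (simp add: carrier_cohomology cocycle_of_cocycle)
  show "cls (cocycle_of (p \<otimes>\<^bsub>?R\<^esub> q)) =
      cls (cocycle_of p) \<otimes>\<^bsub>cohomology_ring G \<rho>\<^esub> cls (cocycle_of q)"
    using ring_hom_mult[OF cls_hom cocycle_of_cocycle[of p] cocycle_of_cocycle[of q]]
    by (simp add: type_ring cocycle_of_mult)
  show "cls (cocycle_of (p \<oplus>\<^bsub>?R\<^esub> q)) =
      cls (cocycle_of p) \<oplus>\<^bsub>cohomology_ring G \<rho>\<^esub> cls (cocycle_of q)"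
    using ring_hom_add[OF cls_hom cocycle_of_cocycle[of p] cocycle_of_cocycle[of q]]
    by (simp add: type_ring cocycle_of_add)
  show "cls (cocycle_of \<one>\<^bsub>?R\<^esub>) = \<one>\<^bsub>cohomology_ring G \<rho>\<^esub>"
    using ring_hom_one[OF cls_hom] cocycle_of_const[of 1]
    by (simp add: type_ring one_pCons)
  have "inj_on (\<lambda>p. cls (cocycle_of p)) UNIV"
  proof (rule inj_onI)
    fix p q assume "cls (cocycle_of p) = cls (cocycle_of q)"
    then obtain k where "k \<in> cochains G \<rho>" "\<forall>xs. cocycle_of p xs + cocycle_of q xs = coboundary G k xs"
      using cls_eq_iff[OF cocycle_of_cocycle cocycle_of_cocycle] by blast
    then have "p + q = 0"
      by (intro cocycle_of_eq_coboundary[of k]) (auto simp: cocycle_of_add)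
    moreover have "q + q = 0" by (rule poly_eqI) (simp only: coeff_add coeff_0 double)
    ultimately show "p = q" by (metis add_right_cancel)
  qed
  moreover have "range (\<lambda>p. cls (cocycle_of p)) = carrier (cohomology_ring G \<rho>)"
  proof -
    have "cls f \<in> range (\<lambda>p. cls (cocycle_of p))" if f: "f \<in> carrier Z" for f
    proof -
      obtain p k where pk: "k \<in> cochains G \<rho>" "\<forall>xs. f xs = cocycle_of p xs + coboundary G k xs"
        using cocycle_cohomologous_cocycle_of[OF f] by blast
      then have "\<forall>xs. f xs + cocycle_of p xs = coboundary G k xs"
        by (simp add: add.commute)
      then have "cls f = cls (cocycle_of p)"
        using cls_eq_iff[OF f cocycle_of_cocycle] pk(1) by blast
      then show ?thesis by blast
    qed
    then show ?thesis by (auto simp: carrier_cohomology cocycle_of_cocycle)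
  qed
  ultimately show "bij_betw (\<lambda>p. cls (cocycle_of p)) (carrier ?R) (carrier (cohomology_ring G \<rho>))"
    by (simp add: bij_betw_def type_ring)
qed

end

section \<open>Rescaling Laurent polynomials\<close>

lemma poly_mapping_eq_sum_single:
  "p = (\<Sum>k\<in>Poly_Mapping.keys p. Poly_Mapping.single k (Poly_Mapping.lookup p k))"
proof (rule poly_mapping_eqI)
  fix j
  show "Poly_Mapping.lookup p j =
    Poly_Mapping.lookup (\<Sum>k\<in>Poly_Mapping.keys p. Poly_Mapping.single k (Poly_Mapping.lookup p k)) j"
  proof (cases "j \<in> Poly_Mapping.keys p")
    case True
    have "Poly_Mapping.lookup (\<Sum>k\<in>Poly_Mapping.keys p. Poly_Mapping.single k (Poly_Mapping.lookup p k)) j =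
        (\<Sum>k\<in>Poly_Mapping.keys p. if j = k then Poly_Mapping.lookup p k else 0)"
      unfolding lookup_sum by (intro sum.cong) (auto simp: lookup_single when_def)
    then show ?thesis using True by simp
  next
    case False
    then have "Poly_Mapping.lookup (\<Sum>k\<in>Poly_Mapping.keys p. Poly_Mapping.single k (Poly_Mapping.lookup p k)) j = 0"
      unfolding lookup_sum by (intro sum.neutral) (auto simp: lookup_single when_def)
    then show ?thesis using False by (simp add: in_keys_iff)
  qed
qed

lemma E2_eqI: "(\<And>k n. fps_nth (Poly_Mapping.lookup p k) n = fps_nth (Poly_Mapping.lookup q k) n) \<Longrightarrow> p = q" for p q :: "'f::field E2"
  by (intro poly_mapping_eqI fps_ext) blast

text \<open>The action is diagonal on the monomials u_1^n u^k, so most identities below are checked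
  one coefficient at a time.\<close>

lemma rescale_nth:
  "fps_nth (Poly_Mapping.lookup (rescale a b p) k) n = b powi k * a ^ n * fps_nth (Poly_Mapping.lookup p k) n"
  by (cases "k \<in> Poly_Mapping.keys p")
    (simp_all add: rescale_def lookup_mapp fps_compose_linear in_keys_iff)

lemma rescale_add: "rescale a b (p + q) = rescale a b p + rescale a b q"
  by (rule E2_eqI) (simp add: rescale_nth lookup_add algebra_simps)

lemma rescale_zero [simp]: "rescale a b 0 = 0"
  by (rule E2_eqI) (simp add: rescale_nth)

lemma rescale_sum: "rescale a b (\<Sum>i\<in>I. f i) = (\<Sum>i\<in>I. rescale a b (f i))"
  by (induction I rule: infinite_finite_induct) (simp_all add: rescale_add)

lemma rescale_single:
  "rescale a b (Poly_Mapping.single k c) =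
     Poly_Mapping.single k (fps_const (b powi k) * (c oo (fps_const a * fps_X)))"
  by (rule E2_eqI) (auto simp: rescale_nth lookup_single when_def fps_compose_linear)

lemma rescale_one: "rescale a b 1 = 1"
  using rescale_single[of a b 0 1] by simp

text \<open>Both sides are additive in p and in q, which leaves single powers of u. There the claim
  is multiplicativity of substitution and of powers of b, whose exponents may be negative.\<close>

lemma rescale_mult:
  assumes "b \<noteq> 0"
  shows "rescale a b (p * q) = rescale a b p * rescale a b q"
proof -
  have single: "rescale a b (Poly_Mapping.single k c * Poly_Mapping.single l d) =
      rescale a b (Poly_Mapping.single k c) * rescale a b (Poly_Mapping.single l d)" for k l c d
  proof -
    have "(fps_const a * fps_X) $ 0 = 0" by simp
    then show ?thesis
      using assms
      by (simp add: mult_single rescale_single fps_compose_mult_distrib power_int_add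
          mult_ac flip: fps_const_mult)
  qed
  let ?s = "\<lambda>p k. Poly_Mapping.single k (Poly_Mapping.lookup p k)"
  have "rescale a b ((\<Sum>k\<in>Poly_Mapping.keys p. ?s p k) * (\<Sum>l\<in>Poly_Mapping.keys q. ?s q l)) =
      rescale a b (\<Sum>k\<in>Poly_Mapping.keys p. ?s p k) * rescale a b (\<Sum>l\<in>Poly_Mapping.keys q. ?s q l)"
    unfolding sum_product rescale_sum single ..
  then show ?thesis
    by (simp flip: poly_mapping_eq_sum_single)
qed

lemma rescale_rescale: "rescale a b (rescale c d p) = rescale (a * c) (b * d) p"
  by (rule E2_eqI) (simp add: rescale_nth power_int_mult_distrib power_mult_distrib)

lemma rescale_1_1: "rescale 1 1 p = p"
  by (rule E2_eqI) (simp add: rescale_nth)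

lemma u_pow_add: "u_pow (k + l) = u_pow k * u_pow l"
  by (simp add: u_pow_def mult_single)

lemma u_pow_0: "u_pow 0 = 1"
  by (simp add: u_pow_def)

lemma u_pow_power: "u_pow k ^ n = u_pow (int n * k)"
  by (induction n) (simp_all add: u_pow_0 algebra_simps flip: u_pow_add)

section \<open>The field with four elements\<close>

locale field_4 =
  fixes \<zeta> \<omega> :: "'f::field"
  assumes card_f: "CARD('f) = 4"
    and zeta: "\<zeta> ^ 3 = 1" "\<zeta> \<noteq> 1"
    and omega: "\<omega> ^ 3 = 1" "\<omega> \<noteq> 1"
begin

lemma nonzero: "\<zeta> \<noteq> 0" "\<omega> \<noteq> 0"
  using zeta omega by auto

lemma zeta_square: "\<zeta>\<^sup>2 \<noteq> 1" "\<zeta>\<^sup>2 \<noteq> \<zeta>"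
  using zeta nonzero by (auto simp: power2_eq_square power3_eq_cube)

lemma field_eq: "(UNIV :: 'f set) = {0, 1, \<zeta>, \<zeta>\<^sup>2}"
proof -
  have "card {0, 1, \<zeta>, \<zeta>\<^sup>2} = 4"
    using zeta nonzero zeta_square by auto
  moreover have "finite (UNIV :: 'f set)"
    using card_f by (intro card_ge_0_finite) simp
  ultimately show ?thesis
    using card_f by (metis card_subset_eq subset_UNIV)
qed

lemma units_eq: "(UNIV - {0} :: 'f set) = {1, \<zeta>, \<zeta>\<^sup>2}"
  using field_eq nonzero by auto

lemma unit_cases:
  assumes "x \<noteq> (0::'f)" obtains "x = 1" | "x = \<zeta>" | "x = \<zeta>\<^sup>2"
  using field_eq assms by blast

lemma unit_cube: "x \<noteq> 0 \<Longrightarrow> x ^ 3 = (1::'f)"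
proof -
  have "(\<zeta>\<^sup>2) ^ 3 = 1"
    using zeta(1) by (metis mult.commute power_mult power_one)
  then show "x \<noteq> 0 \<Longrightarrow> x ^ 3 = 1"
    using zeta(1) by (metis unit_cases power_one)
qed

text \<open>Characteristic two is read off from the unit group of order 3: the cube of -1 is 1 as
  for every unit, but it is also -1.\<close>

lemma double_field: "x + x = (0::'f)"
proof -
  have "(-1::'f) ^ 3 = 1"
    by (rule unit_cube) simp
  then have "(-1::'f) = 1" by (simp add: power3_eq_cube)
  then have "(1::'f) + 1 = 0" by (metis add.right_inverse)
  then show ?thesis by (metis distrib_left mult.right_neutral mult_zero_right)
qed

lemma minus_one_field: "(- 1 :: 'f) = 1"
  using double_field[of 1] by (simp add: neg_eq_iff_add_eq_0)

lemma double_E2: "p + p = (0 :: 'f E2)"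
  by (rule E2_eqI) (simp only: lookup_add lookup_zero fps_add_nth fps_zero_nth double_field)

lemma chi_eq: "chi \<zeta> \<omega> 1 = 1" "chi \<zeta> \<omega> \<zeta> = \<omega>" "chi \<zeta> \<omega> (\<zeta>\<^sup>2) = \<omega>\<^sup>2"
proof -
  have "(LEAST n. \<zeta> ^ n = 1) = 0" by (rule Least_equality) auto
  then show "chi \<zeta> \<omega> 1 = 1" by (simp add: chi_def)
  have "(LEAST n. \<zeta> ^ n = \<zeta>) = 1"
  proof (rule Least_equality)
    fix n assume "\<zeta> ^ n = \<zeta>"
    then have "n \<noteq> 0" using zeta(2) by (metis power_0)
    then show "1 \<le> n" by simp
  qed simp
  then show "chi \<zeta> \<omega> \<zeta> = \<omega>" by (simp add: chi_def)
  have "(LEAST n. \<zeta> ^ n = \<zeta>\<^sup>2) = 2"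
  proof (rule Least_equality)
    fix n assume "\<zeta> ^ n = \<zeta>\<^sup>2"
    moreover have "\<zeta> ^ 0 \<noteq> \<zeta>\<^sup>2" "\<zeta> ^ 1 \<noteq> \<zeta>\<^sup>2" using zeta_square by simp_all
    ultimately have "n \<noteq> 0" "n \<noteq> 1" by metis+
    then show "2 \<le> n" by simp
  qed simp
  then show "chi \<zeta> \<omega> (\<zeta>\<^sup>2) = \<omega>\<^sup>2" by (simp add: chi_def)
qed

lemma chi_nonzero: "x \<noteq> 0 \<Longrightarrow> chi \<zeta> \<omega> x \<noteq> 0"
  by (cases x rule: unit_cases) (simp_all add: chi_eq nonzero)

text \<open>Both \<open>\<zeta>\<close> and \<open>\<omega>\<close> have order 3, so exponents may
  be reduced modulo 3 on either side; nine cases remain.\<close>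

lemma chi_mult: "x \<noteq> 0 \<Longrightarrow> y \<noteq> 0 \<Longrightarrow> chi \<zeta> \<omega> (x * y) = chi \<zeta> \<omega> x * chi \<zeta> \<omega> y"
proof -
  have z: "\<zeta> * \<zeta> = \<zeta>\<^sup>2" "\<zeta> * \<zeta>\<^sup>2 = 1" "\<zeta>\<^sup>2 * \<zeta> = 1" "\<zeta>\<^sup>2 * \<zeta>\<^sup>2 = \<zeta>"
    and w: "\<omega> * \<omega> = \<omega>\<^sup>2" "\<omega> * \<omega>\<^sup>2 = 1" "\<omega>\<^sup>2 * \<omega> = 1" "\<omega>\<^sup>2 * \<omega>\<^sup>2 = \<omega>"
    using zeta(1) omega(1) by (simp_all add: power2_eq_square power3_eq_cube mult.assoc)
  show "x \<noteq> 0 \<Longrightarrow> y \<noteq> 0 \<Longrightarrow> ?thesis"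
    by (cases x rule: unit_cases; cases y rule: unit_cases) (simp_all only: chi_eq z w mult_1_left mult_1_right not_False_eq_True)
qed

section \<open>Invariants of C_3 among coefficients and among polynomials in alpha\<close>

definition fixed :: "'f E2 set" where
  "fixed = {p. rescale \<omega> \<omega> p = p}"

lemma omega_power_eq_1: "\<omega> powi k = 1 \<longleftrightarrow> 3 dvd k"
proof -
  have "\<omega> powi k = \<omega> powi (3 * (k div 3) + k mod 3)" by simp
  also have "\<dots> = \<omega> powi (k mod 3)"
    using nonzero omega(1) by (subst power_int_add) (simp_all add: power_int_mult)
  finally have *: "\<omega> powi k = \<omega> powi (k mod 3)" .
  have "k mod 3 = 0 \<or> k mod 3 = 1 \<or> k mod 3 = 2" by presburger
  moreover have "\<omega>\<^sup>2 \<noteq> 1" using omega by (auto simp: power2_eq_square power3_eq_cube)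
  ultimately have "\<omega> powi (k mod 3) = 1 \<longleftrightarrow> k mod 3 = 0" using omega by auto
  then show ?thesis unfolding dvd_eq_mod_eq_0 by (subst *)
qed

lemma fixed_iff: "p \<in> fixed \<longleftrightarrow> (\<forall>k n. fps_nth (Poly_Mapping.lookup p k) n \<noteq> 0 \<longrightarrow> 3 dvd k + int n)"
proof -
  have "p \<in> fixed \<longleftrightarrow> (\<forall>k n. \<omega> powi k * \<omega> ^ n * fps_nth (Poly_Mapping.lookup p k) n = fps_nth (Poly_Mapping.lookup p k) n)"
    unfolding fixed_def rescale_nth[symmetric] by (auto intro: E2_eqI)
  moreover have "\<omega> powi k * \<omega> ^ n * c = c \<longleftrightarrow> (c \<noteq> 0 \<longrightarrow> 3 dvd k + int n)" for k n c
    using omega_power_eq_1[of "k + int n"] nonzero by (auto simp add: power_int_add)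
  ultimately show ?thesis by simp
qed

lemma fixed_zero: "0 \<in> fixed" by (simp add: fixed_def)
lemma fixed_one: "1 \<in> fixed" by (simp add: fixed_def rescale_one)
lemma fixed_add: "p \<in> fixed \<Longrightarrow> q \<in> fixed \<Longrightarrow> p + q \<in> fixed" by (simp add: fixed_def rescale_add)
lemma fixed_mult: "p \<in> fixed \<Longrightarrow> q \<in> fixed \<Longrightarrow> p * q \<in> fixed" by (simp add: fixed_def rescale_mult nonzero)

lemma fixed_sum: "(\<And>i. i \<in> I \<Longrightarrow> f i \<in> fixed) \<Longrightarrow> (\<Sum>i\<in>I. f i) \<in> fixed"
  by (induction I rule: infinite_finite_induct) (simp_all add: fixed_zero fixed_add)

text \<open>The factor \<open>u_pow (- int i)\<close> records the action on alpha^i, which is by the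
  same scalar as on u^-i.\<close>

definition fixed_poly :: "'f E2 poly set" where
  "fixed_poly = {p. \<forall>i. Polynomial.coeff p i * u_pow (- int i) \<in> fixed}"

lemma fixed_poly_mult:
  assumes "p \<in> fixed_poly" "q \<in> fixed_poly"
  shows "p * q \<in> fixed_poly"
proof -
  have "Polynomial.coeff (p * q) n * u_pow (- int n) \<in> fixed" for n
  proof -
    have "Polynomial.coeff (p * q) n * u_pow (- int n) =
        (\<Sum>i\<le>n. (Polynomial.coeff p i * u_pow (- int i)) * (Polynomial.coeff q (n - i) * u_pow (- int (n - i))))"
      unfolding coeff_mult sum_distrib_right
    proof (rule sum.cong)
      fix i assume "i \<in> {..n}"
      then have "u_pow (- int n) = u_pow (- int i) * (u_pow (- int (n - i)) :: 'f E2)"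
        by (simp flip: u_pow_add)
      then show "Polynomial.coeff p i * Polynomial.coeff q (n - i) * u_pow (- int n) =
          Polynomial.coeff p i * u_pow (- int i) * (Polynomial.coeff q (n - i) * u_pow (- int (n - i)))"
        by (simp add: mult_ac)
    qed simp
    also have "\<dots> \<in> fixed"
    proof (rule fixed_sum)
      fix i
      have "Polynomial.coeff p i * u_pow (- int i) \<in> fixed"
        "Polynomial.coeff q (n - i) * u_pow (- int (n - i)) \<in> fixed"
        using assms unfolding fixed_poly_def by blast+
      then show "Polynomial.coeff p i * u_pow (- int i) *
          (Polynomial.coeff q (n - i) * u_pow (- int (n - i))) \<in> fixed"
        by (rule fixed_mult)
    qed
    finally show ?thesis .
  qed
  then show ?thesis by (simp add: fixed_poly_def)
qed

lemma fixed_poly_add: "p \<in> fixed_poly \<Longrightarrow> q \<in> fixed_poly \<Longrightarrow> p + q \<in> fixed_poly"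
  by (simp add: fixed_poly_def distrib_right fixed_add)

lemma fixed_poly_const: "a \<in> fixed \<Longrightarrow> [:a:] \<in> fixed_poly"
  by (simp add: fixed_poly_def coeff_pCons fixed_zero u_pow_0 split: nat.split)

section \<open>Generation of the invariants\<close>

definition generators :: "'f E2 set" where
  "generators = range (\<lambda>c. ser (c oo fps_X ^ 3)) \<union> {u1 * u_pow (-1), u_pow (-3), u_pow 3}"

lemma generators_fixed: "generators \<subseteq> fixed"
proof -
  have "ser (c oo fps_X ^ 3) \<in> fixed" for c
    unfolding fixed_iff
    by (auto simp: ser_def lookup_single when_def fps_nth_compose_X_power split: if_splits)
  moreover have "u1 * u_pow (-1) \<in> fixed"
    by (auto simp: fixed_iff u1_def ser_def u_pow_def mult_single lookup_single when_def split: if_splits)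
  moreover have "u_pow (-3) \<in> fixed" "u_pow 3 \<in> fixed"
    by (auto simp: fixed_iff u_pow_def lookup_single when_def split: if_splits)
  ultimately show ?thesis by (auto simp: generators_def)
qed

lemma fixed_poly_w: "[:0, u_pow (-2):] \<in> fixed_poly"
proof -
  have "u_pow (-2) * u_pow (-1) \<in> fixed"
    using generators_fixed by (auto simp: generators_def simp flip: u_pow_add)
  then show ?thesis
    by (auto simp: fixed_poly_def coeff_pCons fixed_zero split: nat.split)
qed

text \<open>In a fixed term c u^k only exponents of u_1 congruent to r = -k modulo 3 occur. With k +
  r = 3j it factors as d(u_1^3) (u_1 u^-1)^r (u^3)^j, and the whole infinite sum sits in the one
  series d.\<close>

lemma fixed_single_induct:
  assumes gen: "generators \<subseteq> A" and one: "1 \<in> A"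
    and mult: "\<And>p q. p \<in> A \<Longrightarrow> q \<in> A \<Longrightarrow> p * q \<in> A"
    and fixed: "Poly_Mapping.single k c \<in> fixed"
  shows "Poly_Mapping.single k c \<in> A"
proof -
  have power: "p ^ n \<in> A" if "p \<in> A" for p n
    using that by (induction n) (simp_all add: one mult)
  define r where "r = nat (- k mod 3)"
  have r: "int r = - k mod 3" by (simp add: r_def)
  have "3 dvd k + int r"
    unfolding r by presburger
  then obtain j where j: "k + int r = 3 * j"
    by (rule dvdE)
  \<comment> \<open>Collects the coefficients of c at r, r + 3, r + 6, and so on; all others vanish
    by invariance.\<close>
  define d where "d = Abs_fps (\<lambda>m. fps_nth c (3 * m + r))"
  have c: "c = fps_X ^ r * (d oo fps_X ^ 3)"
  proof (rule fps_ext)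
    fix n
    have coeff: "fps_nth c n \<noteq> 0 \<Longrightarrow> 3 dvd k + int n"
      using fixed unfolding fixed_iff by (metis lookup_single_eq)
    have r3: "r < 3" by (simp add: r_def)
    have dvd_iff: "3 dvd k + int n \<longleftrightarrow> n \<ge> r \<and> 3 dvd n - r"
    proof -
      have "3 dvd k + int n \<longleftrightarrow> 3 dvd int n - int r"
        using j by presburger
      also have "\<dots> \<longleftrightarrow> n \<ge> r \<and> 3 dvd n - r"
        using r3 by presburger
      finally show ?thesis .
    qed
    show "fps_nth c n = fps_nth (fps_X ^ r * (d oo fps_X ^ 3)) n"
    proof (cases "3 dvd k + int n")
      case True
      then show ?thesis
        using dvd_iff by (auto simp: fps_X_power_mult_nth fps_nth_compose_X_power d_def)
    next
      case False
      then show ?thesis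
        using coeff dvd_iff by (auto simp: fps_X_power_mult_nth fps_nth_compose_X_power)
    qed
  qed
  have u1_power: "u1 ^ n = (Poly_Mapping.single 0 (fps_X ^ n) :: 'f E2)" for n
    by (induction n) (simp_all add: u1_def ser_def mult_single)
  have "Poly_Mapping.single k c = ser (d oo fps_X ^ 3) * (u1 ^ r * u_pow (- int r)) * u_pow (3 * j)"
    unfolding u1_power j[symmetric]
    by (simp add: c ser_def u_pow_def mult_single mult.commute)
  moreover have "u1 ^ r * u_pow (- int r) = (u1 * u_pow (-1)) ^ r"
    by (simp add: power_mult_distrib u_pow_power)
  moreover have "u_pow (3 * j) \<in> A"
  proof (cases "j \<ge> 0")
    case True
    then have "u_pow (3 * j) = (u_pow 3 :: 'f E2) ^ nat j" by (simp add: u_pow_power mult.commute)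
    then show ?thesis using gen power by (simp add: generators_def)
  next
    case False
    then have "u_pow (3 * j) = (u_pow (-3) :: 'f E2) ^ nat (- j)" by (simp add: u_pow_power mult.commute)
    then show ?thesis using gen power by (simp add: generators_def)
  qed
  moreover have "ser (d oo fps_X ^ 3) \<in> A" "(u1 * u_pow (-1)) ^ r \<in> A"
    using gen power by (auto simp: generators_def)
  ultimately show ?thesis using mult by metis
qed

text \<open>Phrased with a set A in the arithmetic of the type, so that it can be applied to a
  subring generated in the sense of HOL-Algebra.\<close>

lemma fixed_poly_induct:
  assumes gen: "\<And>a. a \<in> generators \<Longrightarrow> [:a:] \<in> A" and w: "[:0, u_pow (-2):] \<in> A" and one: "1 \<in> A"
    and add: "\<And>p q. p \<in> A \<Longrightarrow> q \<in> A \<Longrightarrow> p + q \<in> A"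
    and mult: "\<And>p q. p \<in> A \<Longrightarrow> q \<in> A \<Longrightarrow> p * q \<in> A"
    and p: "p \<in> fixed_poly"
  shows "p \<in> A"
proof -
  have "1 + 1 = (0 :: 'f E2 poly)"
    by (rule poly_eqI) (simp only: coeff_add coeff_0 double_E2)
  then have zero: "0 \<in> A" using add[OF one one] by simp
  have sum: "(\<Sum>i\<in>I. f i) \<in> A" if "\<And>i. i \<in> I \<Longrightarrow> f i \<in> A" for f :: "'i \<Rightarrow> 'f E2 poly" and I
    using that by (induction I rule: infinite_finite_induct) (simp_all add: zero add)
  have power: "q ^ n \<in> A" if "q \<in> A" for q n
    using that by (induction n) (simp_all add: one mult)
  have const: "[:b:] \<in> A" if b: "b \<in> fixed" for b
  proof -
    have "[:Poly_Mapping.single k (Poly_Mapping.lookup b k):] \<in> A" for k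
    proof -
      have "Poly_Mapping.single k (Poly_Mapping.lookup b k) \<in> fixed"
        using b by (auto simp: fixed_iff lookup_single when_def split: if_splits)
      then have "Poly_Mapping.single k (Poly_Mapping.lookup b k) \<in> {a. [:a:] \<in> A}"
      proof (rule fixed_single_induct[rotated -1])
        show "generators \<subseteq> {a. [:a:] \<in> A}" using gen by blast
        show "1 \<in> {a. [:a:] \<in> A}" using one by (simp add: one_pCons)
        fix a b assume "a \<in> {a. [:a:] \<in> A}" "b \<in> {a. [:a:] \<in> A}"
        then have "[:a:] * [:b:] \<in> A" by (intro mult) simp_all
        then show "a * b \<in> {a. [:a:] \<in> A}" by (simp add: mult.commute)
      qed
      then show ?thesis by simp
    qed
    then have "(\<Sum>k\<in>Poly_Mapping.keys b. [:Poly_Mapping.single k (Poly_Mapping.lookup b k):]) \<in> A" by (intro sum)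
    moreover have "(\<Sum>k\<in>I. [:f k:]) = [:\<Sum>k\<in>I. f k:]" for f :: "int \<Rightarrow> 'f E2" and I
      by (induction I rule: infinite_finite_induct) simp_all
    ultimately show ?thesis by (simp flip: poly_mapping_eq_sum_single)
  qed
  \<comment> \<open>Since alpha^i = w^i u^(2i) and 2i = 3i - i, the term a alpha^i equals (a u^-i)
    (u^3)^i w^i, in which every factor is invariant.\<close>
  have "monom (Polynomial.coeff p i) i \<in> A" for i
  proof -
    let ?b = "Polynomial.coeff p i * u_pow (- int i)"
    have "u_pow 3 \<in> fixed" using generators_fixed by (auto simp: generators_def)
    then have "u_pow 3 ^ i \<in> fixed" by (induction i) (simp_all add: fixed_one fixed_mult)
    moreover have "?b \<in> fixed" using p by (simp add: fixed_poly_def)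
    ultimately have "?b * u_pow 3 ^ i \<in> fixed" by (intro fixed_mult[of ?b])
    then have "[:?b * u_pow 3 ^ i:] * [:0, u_pow (-2):] ^ i \<in> A"
      by (intro mult const power w)
    moreover have "[:?b * u_pow 3 ^ i:] * [:0, u_pow (-2):] ^ i = monom (Polynomial.coeff p i) i"
    proof -
      have "[:0, u_pow (-2):] ^ i = monom (u_pow (-2) ^ i :: 'f E2) i"
        by (induction i) (simp_all add: monom_Suc smult_monom one_pCons monom_0)
      moreover have "u_pow (- int i) * u_pow 3 ^ i * u_pow (-2) ^ i = (1 :: 'f E2)"
        by (simp add: u_pow_power u_pow_0 flip: u_pow_add)
      ultimately show ?thesis
        by (simp add: smult_monom mult.assoc)
    qed
    ultimately show ?thesis by simp
  qed
  then have "(\<Sum>i\<le>Polynomial.degree p. monom (Polynomial.coeff p i) i) \<in> A" by (intro sum)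
  then show ?thesis by (simp add: poly_as_sum_of_monoms)
qed

end

section \<open>The cohomology of \<open>C\<^sub>6\<close>\<close>

text \<open>Lets generation be proved among polynomials and then carried over to cohomology
  classes.\<close>

lemma (in ring_hom_ring) image_generate_ring:
  assumes "A \<subseteq> carrier R"
  shows "h ` generate_ring R A = generate_ring S (h ` A)"
proof
  have in_R: "a \<in> carrier R" if "a \<in> generate_ring R A" for a
    using R.generate_ring_in_carrier[OF assms that] .
  have "h a \<in> generate_ring S (h ` A)" if "a \<in> generate_ring R A" for a
    using that
  proof (induction rule: generate_ring.induct)
    case one
    show ?case unfolding hom_one by (rule generate_ring.one)
  next
    case (incl a)
    then show ?case by (intro generate_ring.incl imageI)
  next
    case (a_inv a)
    show ?case unfolding hom_a_inv[OF in_R[OF a_inv.hyps]] by (rule generate_ring.a_inv[OF a_inv.IH])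
  next
    case (eng_add a b)
    show ?case unfolding hom_add[OF in_R[OF eng_add.hyps(1)] in_R[OF eng_add.hyps(2)]]
      by (rule generate_ring.eng_add[OF eng_add.IH])
  next
    case (eng_mult a b)
    show ?case unfolding hom_mult[OF in_R[OF eng_mult.hyps(1)] in_R[OF eng_mult.hyps(2)]]
      by (rule generate_ring.eng_mult[OF eng_mult.IH])
  qed
  then show "h ` generate_ring R A \<subseteq> generate_ring S (h ` A)" by (rule image_subsetI)
  have "\<exists>a. a \<in> generate_ring R A \<and> b = h a" if "b \<in> generate_ring S (h ` A)" for b
    using that
  proof (induction rule: generate_ring.induct)
    case one
    show ?case using generate_ring.one[of R A] hom_one by metis
  next
    case (incl b)
    then obtain a where "a \<in> A" "b = h a" by (rule imageE)
    then show ?case using generate_ring.incl[of a A R] by metis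
  next
    case (a_inv b)
    then obtain a where "a \<in> generate_ring R A" "b = h a" by metis
    then show ?case using generate_ring.a_inv[of a R A] hom_a_inv[OF in_R] by metis
  next
    case (eng_add b c)
    then obtain a a' where "a \<in> generate_ring R A" "b = h a" "a' \<in> generate_ring R A" "c = h a'"
      by metis
    then show ?case using generate_ring.eng_add[of a R A a'] hom_add[OF in_R in_R] by metis
  next
    case (eng_mult b c)
    then obtain a a' where "a \<in> generate_ring R A" "b = h a" "a' \<in> generate_ring R A" "c = h a'"
      by metis
    then show ?case using generate_ring.eng_mult[of a R A a'] hom_mult[OF in_R in_R] by metis
  qed
  then show "generate_ring S (h ` A) \<subseteq> h ` generate_ring R A" by auto
qed

lemma type_ring_simps:
  "carrier (ring_of_type_algebra :: 'a::comm_ring_1 ring) = UNIV"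
  "x \<otimes>\<^bsub>ring_of_type_algebra\<^esub> y = x * (y :: 'a)"
  "x \<oplus>\<^bsub>ring_of_type_algebra\<^esub> y = x + (y :: 'a)"
  "\<one>\<^bsub>ring_of_type_algebra\<^esub> = (1 :: 'a)"
  by (simp_all add: ring_of_type_algebra_def)

lemma type_ring_nat_pow:
  "x [^]\<^bsub>ring_of_type_algebra\<^esub> (n::nat) = (x :: 'a::comm_ring_1) ^ n"
  by (induction n) (simp_all add: type_ring_simps mult.commute)

context field_4
begin

abbreviation "G6 \<equiv> C6 :: (int \<times> 'f) monoid"
abbreviation "G2 \<equiv> G6\<lparr>carrier := C2_in_C6\<rparr>"

lemma C6_simps:
  "carrier G6 = {1, -1} \<times> (UNIV - {0})" "x \<otimes>\<^bsub>G6\<^esub> y = (fst x * fst y, snd x * snd y)" "\<one>\<^bsub>G6\<^esub> = (1, 1)"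
  by (simp_all add: C6_def DirProd_def case_prod_beta)

lemma C6_carrier_iff: "g \<in> carrier G6 \<longleftrightarrow> (fst g = 1 \<or> fst g = -1) \<and> snd g \<noteq> 0"
  by (cases g) (auto simp: C6_simps)

text \<open>The sign acts through its image in F_4, where -1 = 1. This makes the action of C_2
  trivial modulo 2.\<close>

lemma act_eq: "g \<in> carrier G6 \<Longrightarrow> act \<zeta> \<omega> g = rescale (chi \<zeta> \<omega> (snd g)) (chi \<zeta> \<omega> (snd g))"
  by (auto simp: act_def C6_carrier_iff minus_one_field)

lemma comm_group_C6: "comm_group G6"
proof (rule comm_groupI)
  fix x assume "x \<in> carrier G6"
  then show "\<exists>y\<in>carrier G6. y \<otimes>\<^bsub>G6\<^esub> x = \<one>\<^bsub>G6\<^esub>"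
    by (intro bexI[of _ "(fst x, inverse (snd x))"]) (auto simp: C6_carrier_iff C6_simps(2,3))
qed (auto simp: C6_carrier_iff C6_simps(2,3) prod_eq_iff)

sublocale C6: odd_retract G6 "act \<zeta> \<omega>" "\<lambda>g. (fst g, 1)" C2_in_C6 C3_in_C6
proof (intro odd_retract.intro comm_group_C6)
  show "char2_action G6 (act \<zeta> \<omega>)"
    by unfold_locales
      (auto simp: act_eq rescale_add rescale_mult rescale_one double_E2 C6_carrier_iff
        C6_simps(2) chi_nonzero simp del: mult_2)
  show "odd_retract_axioms G6 (act \<zeta> \<omega>) (\<lambda>g. (fst g, 1)) C2_in_C6 C3_in_C6"
  proof
    fix g h a assume *: "g \<in> carrier G6" "h \<in> carrier G6"
    then have "g \<otimes>\<^bsub>G6\<^esub> h \<in> carrier G6" by (auto simp: C6_carrier_iff C6_simps(2))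
    then show "act \<zeta> \<omega> (g \<otimes>\<^bsub>G6\<^esub> h) a = act \<zeta> \<omega> g (act \<zeta> \<omega> h a)"
      using * by (simp add: act_eq rescale_rescale chi_mult C6_simps(2) C6_carrier_iff)
  next
    have "\<zeta>\<^sup>2 \<noteq> \<zeta>" "\<zeta>\<^sup>2 \<noteq> 1" by (fact zeta_square)+
    then have "card (UNIV - {0} :: 'f set) = 3"
      using zeta(2) by (simp add: units_eq)
    then show "odd (card (C3_in_C6 :: (int \<times> 'f) set))"
      by (simp add: C3_in_C6_def card_cartesian_product)
  qed (auto simp: C6_carrier_iff C6_simps(2,3) C2_in_C6_def C3_in_C6_def)
qed

sublocale C2: trivial_C2 G2 "act \<zeta> \<omega>" "(1, 1)" "(-1, 1)" "u_pow (-1)" "u_pow 1"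
proof
  fix g a assume "g \<in> carrier G2"
  then have "g \<in> carrier G6" "snd g = 1" by (auto simp: C2_in_C6_def C6_carrier_iff)
  then show "act \<zeta> \<omega> g a = a" by (simp add: act_eq chi_eq rescale_1_1)
qed (auto simp: C2_in_C6_def C6_simps(2) u_pow_0 simp flip: u_pow_add)

text \<open>Half the difference of two signs is 0 for equal signs and 1 or -1 for unequal ones; in
  characteristic two the latter agree.\<close>

lemma alpha_cocycle_eq: "alpha_cocycle = C2.cocycle_of [:0, 1:]"
proof
  fix xs :: "(int \<times> 'f) list"
  consider "xs = []" | x where "xs = [x]" | x y where "xs = [x, y]" | x y z zs where "xs = x # y # z # zs"
    by (metis remdups_adj.cases list.exhaust)
  then show "alpha_cocycle xs = C2.cocycle_of [:0, 1:] xs"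
  proof cases
    case 3
    show ?thesis
    proof (cases "x \<in> {(1, 1), (-1, 1)} \<and> y \<in> {(1, 1), (-1, 1)}")
      case True
      have "- 1 = (1 :: 'f E2)" using double_E2[of 1] by (simp add: neg_eq_iff_add_eq_0)
      then show ?thesis using True 3 by (auto simp: alpha_cocycle_def C2.cocycle_of_def C2_in_C6_def)
    next
      case False
      then show ?thesis using 3 by (auto simp: alpha_cocycle_def C2.cocycle_of_def C2_in_C6_def)
    qed
  qed (simp_all add: alpha_cocycle_def C2.cocycle_of_def)
qed

text \<open>The same map as \<open>eval_alpha\<close>, but given by one explicit cocycle instead of
  a sum of products of classes.\<close>

definition cls_of :: "'f E2 poly \<Rightarrow> ((int \<times> 'f) list \<Rightarrow> 'f E2) set" where
  "cls_of p = cohomology_class G2 (act \<zeta> \<omega>) (C2.cocycle_of p)"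

lemma cls_of_iso: "cls_of \<in> ring_iso ring_of_type_algebra (H_C2 \<zeta> \<omega>)"
  using C2.cocycle_of_ring_iso by (simp add: cls_of_def[abs_def] H_C2_def)

sublocale ev: ring_hom_ring "ring_of_type_algebra :: 'f E2 poly ring" "H_C2 \<zeta> \<omega>" cls_of
  using cls_of_iso C6.H.cohomology_ring
  by (intro ring_hom_ringI2) (auto simp: ring_iso_def H_C2_def)

lemma cls_of_mult: "cls_of (p * q) = cls_of p \<otimes>\<^bsub>H_C2 \<zeta> \<omega>\<^esub> cls_of q"
  using ev.hom_mult[of p q] by (simp add: type_ring_simps)

lemma cls_of_add: "cls_of (p + q) = cls_of p \<oplus>\<^bsub>H_C2 \<zeta> \<omega>\<^esub> cls_of q"
  using ev.hom_add[of p q] by (simp add: type_ring_simps)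

lemma cls_of_power: "cls_of (p ^ n) = cls_of p [^]\<^bsub>H_C2 \<zeta> \<omega>\<^esub> n"
  using ev.hom_nat_pow[of p n] by (simp add: type_ring_simps type_ring_nat_pow)

lemma cls_of_carrier: "cls_of p \<in> carrier (H_C2 \<zeta> \<omega>)"
  using ev.hom_closed[of p] by (simp add: type_ring_simps)

lemma cls_of_eq_iff: "cls_of p = cls_of q \<longleftrightarrow> p = q"
  and range_cls_of: "range cls_of = carrier (H_C2 \<zeta> \<omega>)"
  using cls_of_iso by (auto simp: ring_iso_def bij_betw_def type_ring_simps inj_eq)

lemma coef_eq: "coef \<zeta> \<omega> a = cls_of [:a:]"
  by (simp add: coef_def cls_of_def C2.cocycle_of_const)

lemma alpha_eq: "alpha \<zeta> \<omega> = cls_of [:0, 1:]"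
  by (simp add: alpha_def cls_of_def alpha_cocycle_eq)

lemma w_class_eq: "w_class \<zeta> \<omega> = cls_of [:0, u_pow (-2):]"
  by (simp add: w_class_def alpha_eq coef_eq flip: cls_of_mult)

lemma eval_alpha_eq: "eval_alpha \<zeta> \<omega> p = cls_of p"
proof -
  have monom: "Polynomial.smult a ([:0, 1:] ^ i) = monom a i" for a :: "'f E2" and i
    by (simp add: monom_altdef)
  have "(\<Oplus>\<^bsub>H_C2 \<zeta> \<omega>\<^esub> i\<in>{..n}. cls_of (f i)) = cls_of (\<Sum>i\<le>n. f i)" for f and n :: nat
    by (induction n) (simp_all add: cls_of_carrier cls_of_add ev.S.a_comm add.commute)
  note sum = this[of "\<lambda>i. monom (Polynomial.coeff p i) i" "Polynomial.degree p"]
  then show ?thesis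
    unfolding eval_alpha_def coef_eq alpha_eq
    by (simp add: monom poly_as_sum_of_monoms flip: cls_of_power cls_of_mult)
qed

text \<open>C_3 is cyclic: invariance under \<open>\<zeta>\<close>, which rescales by
  \<open>\<omega>\<close>, forces invariance under its square, which rescales by
  \<open>\<omega>\<close> squared.\<close>

lemma fixed_iff_act: "b \<in> fixed \<longleftrightarrow> (\<forall>k\<in>C3_in_C6. act \<zeta> \<omega> k b = b)"
proof
  assume b: "b \<in> fixed"
  show "\<forall>k\<in>C3_in_C6. act \<zeta> \<omega> k b = b"
  proof
    fix k :: "int \<times> 'f" assume k: "k \<in> C3_in_C6"
    then have kc: "k \<in> carrier G6" and nz: "snd k \<noteq> 0" by (auto simp: C3_in_C6_def C6_carrier_iff)
    have square: "rescale (\<omega>\<^sup>2) (\<omega>\<^sup>2) b = b"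
      using b rescale_rescale[of \<omega> \<omega> \<omega> \<omega> b] by (simp add: fixed_def power2_eq_square)
    show "act \<zeta> \<omega> k b = b"
      by (rule unit_cases[OF nz])
        (use b square in \<open>simp_all add: act_eq[OF kc] chi_eq rescale_1_1 fixed_def\<close>)
  qed
next
  assume "\<forall>k\<in>C3_in_C6. act \<zeta> \<omega> k b = b"
  moreover have "(1, \<zeta>) \<in> C3_in_C6" "(1, \<zeta>) \<in> carrier G6"
    by (auto simp: C3_in_C6_def C6_carrier_iff nonzero)
  ultimately show "b \<in> fixed"
    by (auto simp: fixed_def act_eq chi_eq dest!: bspec)
qed

text \<open>Acting on values preserves the support on alternating lists, so the twisted cocycle is
  again exactly of the form \<open>cocycle_of q\<close>. Its value in degree i is k applied to the
  coefficient times u^-i, and the factor u^i in \<open>F\<close> converts this value back into a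
  coefficient. As a class determines its polynomial, invariance becomes an equation of
  coefficients.\<close>

lemma residual_action_cls_of:
  assumes k: "k \<in> carrier G6"
  shows "residual_action G6 (act \<zeta> \<omega>) C2_in_C6 k (cls_of p) = cls_of p \<longleftrightarrow>
    (\<forall>i. act \<zeta> \<omega> k (Polynomial.coeff p i * u_pow (- int i)) = Polynomial.coeff p i * u_pow (- int i))"
proof -
  define F where "F i = act \<zeta> \<omega> k (Polynomial.coeff p i * u_pow (- int i)) * u_pow (int i)" for i
  define q where "q = (\<Sum>i\<le>Polynomial.degree p. monom (F i) i)"
  have F0: "F i = 0" if "i > Polynomial.degree p" for i
    using that k by (simp add: F_def coeff_eq_0 C6.act_zero)
  have coeff_q: "Polynomial.coeff q i = F i" for i
    using F0[of i] by (auto simp: q_def coeff_sum not_le)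
  have inverse: "u_pow (int i) * u_pow (- int i) = (1 :: 'f E2)" for i
    by (simp add: u_pow_0 flip: u_pow_add)
  have "C6.twist k (C2.cocycle_of p) = C2.cocycle_of q"
  proof
    fix xs
    have "set xs \<subseteq> C2_in_C6" if "C2.alternating xs"
      using C2.alternating_carrier[OF that] by simp
    moreover have "F i * u_pow (- int i) = act \<zeta> \<omega> k (Polynomial.coeff p i * u_pow (- int i))" for i
      by (simp add: F_def mult.assoc inverse)
    ultimately show "C6.twist k (C2.cocycle_of p) xs = C2.cocycle_of q xs"
      using k by (auto simp: C6.twist_def C2.cocycle_of_def coeff_q u_pow_power C6.act_zero)
  qed
  then have "residual_action G6 (act \<zeta> \<omega>) C2_in_C6 k (cls_of p) = cls_of q"
    using C6.residual_action_cls[OF k C2.cocycle_of_cocycle[of p]] by (simp add: cls_of_def)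
  then have "residual_action G6 (act \<zeta> \<omega>) C2_in_C6 k (cls_of p) = cls_of p \<longleftrightarrow>
      (\<forall>i. F i = Polynomial.coeff p i)"
    by (simp add: cls_of_eq_iff poly_eq_iff coeff_q)
  moreover have "F i = Polynomial.coeff p i \<longleftrightarrow>
      act \<zeta> \<omega> k (Polynomial.coeff p i * u_pow (- int i)) = Polynomial.coeff p i * u_pow (- int i)" for i
  proof -
    have "a * u_pow (int i) = c \<longleftrightarrow> a = c * u_pow (- int i)" for a c :: "'f E2"
      using inverse[of i] by (auto simp: mult.assoc mult.commute[of "u_pow (- int i)"])
    then show ?thesis unfolding F_def .
  qed
  ultimately show ?thesis by presburger
qed

lemma invariants_eq: "H_C2_C3_invariants \<zeta> \<omega> = cls_of ` fixed_poly"
proof -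
  have "cls_of p \<in> H_C2_C3_invariants \<zeta> \<omega> \<longleftrightarrow> p \<in> fixed_poly" for p
    using cls_of_carrier[of p]
    by (auto simp: H_C2_C3_invariants_def residual_invariants_def residual_action_cls_of
        C6.K_carrier fixed_poly_def fixed_iff_act H_C2_def)
  moreover have "H_C2_C3_invariants \<zeta> \<omega> \<subseteq> range cls_of"
    unfolding range_cls_of by (auto simp: H_C2_C3_invariants_def residual_invariants_def H_C2_def)
  ultimately show ?thesis by blast
qed

lemma fixed_poly_eq_generate_ring:
  "fixed_poly = generate_ring ring_of_type_algebra ((\<lambda>a. [:a:]) ` generators \<union> {[:0, u_pow (-2):]})"
    (is "_ = generate_ring ?P ?S")
proof
  show "fixed_poly \<subseteq> generate_ring ?P ?S"
  proof
    fix p assume "p \<in> fixed_poly"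
    then show "p \<in> generate_ring ?P ?S"
    proof (rule fixed_poly_induct[rotated -1])
      show "1 \<in> generate_ring ?P ?S"
        using generate_ring.one[of ?P ?S] by (simp add: type_ring_simps)
    next
      fix p q assume "p \<in> generate_ring ?P ?S" "q \<in> generate_ring ?P ?S"
      then show "p + q \<in> generate_ring ?P ?S" "p * q \<in> generate_ring ?P ?S"
        using generate_ring.eng_add[of p ?P ?S q] generate_ring.eng_mult[of p ?P ?S q]
        by (simp_all add: type_ring_simps)
    qed (auto intro: generate_ring.incl)
  qed
  show "generate_ring ?P ?S \<subseteq> fixed_poly"
  proof
    fix p assume "p \<in> generate_ring ?P ?S"
    then show "p \<in> fixed_poly"
    proof induction
      case one
      show ?case using fixed_poly_const[OF fixed_one] by (simp add: type_ring_simps one_pCons)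
    next
      case (incl p)
      then show ?case using generators_fixed fixed_poly_const fixed_poly_w by auto
    next
      case (a_inv p)
      have "p + p = 0" by (rule poly_eqI) (simp only: coeff_add coeff_0 double_E2)
      moreover have "\<zero>\<^bsub>?P\<^esub> = 0" by (simp add: ring_of_type_algebra_def)
      ultimately have "\<ominus>\<^bsub>?P\<^esub> p = p"
        by (intro ev.R.minus_equality) (simp_all add: type_ring_simps)
      then show ?case using a_inv by simp
    next
      case (eng_add p q)
      then show ?case by (simp add: type_ring_simps fixed_poly_add)
    next
      case (eng_mult p q)
      then show ?case by (simp add: type_ring_simps fixed_poly_mult)
    qed
  qed
qed

end

theorem lemma5p1:
  fixes \<zeta> \<omega> :: "'f::field"
  assumes "CARD('f) = 4"
    and "\<zeta> ^ 3 = 1" "\<zeta> \<noteq> 1"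
    and "\<omega> ^ 3 = 1" "\<omega> \<noteq> 1"
  shows "eval_alpha \<zeta> \<omega> \<in> ring_iso (ring_of_type_algebra :: 'f E2 poly ring) (H_C2 \<zeta> \<omega>) \<and>
    res_C6_C2 \<zeta> \<omega> \<in> ring_iso (H_C6 \<zeta> \<omega>) ((H_C2 \<zeta> \<omega>)\<lparr>carrier := H_C2_C3_invariants \<zeta> \<omega>\<rparr>) \<and>
    res_C6_C2 \<zeta> \<omega> ` carrier (H_C6 \<zeta> \<omega>) =
      generate_ring (H_C2 \<zeta> \<omega>)
        (coef \<zeta> \<omega> ` (range (\<lambda>c. ser (c oo fps_X ^ 3)) \<union> {u1 * u_pow (-1), u_pow (-3), u_pow 3})
         \<union> {w_class \<zeta> \<omega>})"
proof -
  interpret field_4 \<zeta> \<omega> using assms by unfold_locales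
  have "eval_alpha \<zeta> \<omega> = cls_of"
    by (rule ext) (rule eval_alpha_eq)
  then have 1: "eval_alpha \<zeta> \<omega> \<in> ring_iso ring_of_type_algebra (H_C2 \<zeta> \<omega>)"
    using cls_of_iso by simp
  have 2: "res_C6_C2 \<zeta> \<omega> \<in> ring_iso (H_C6 \<zeta> \<omega>) ((H_C2 \<zeta> \<omega>)\<lparr>carrier := H_C2_C3_invariants \<zeta> \<omega>\<rparr>)"
    using C6.restriction_ring_iso
    by (simp add: res_C6_C2_def H_C6_def H_C2_def H_C2_C3_invariants_def)
  then have "res_C6_C2 \<zeta> \<omega> ` carrier (H_C6 \<zeta> \<omega>) = H_C2_C3_invariants \<zeta> \<omega>"
    by (simp add: ring_iso_def bij_betw_def)
  also have "\<dots> = generate_ring (H_C2 \<zeta> \<omega>) (cls_of ` ((\<lambda>a. [:a:]) ` generators \<union> {[:0, u_pow (-2):]}))"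
    unfolding invariants_eq fixed_poly_eq_generate_ring
    by (rule ev.image_generate_ring) (simp add: type_ring_simps)
  also have "cls_of ` ((\<lambda>a. [:a:]) ` generators \<union> {[:0, u_pow (-2):]}) = coef \<zeta> \<omega> ` generators \<union> {w_class \<zeta> \<omega>}"
    by (simp add: image_Un image_image w_class_eq flip: coef_eq)
  finally show ?thesis using 1 2 by (simp add: generators_def)
qed

end
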